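(* Let $M$ be a countable transitive model of (a sufficiently large fragment of) ZFC. Let $\mathbb P\in M$ be a tree forcing on $\omega^{<\omega}$ whose generic branch $x\in\omega^\omega$ generates the generic extension, and suppose that for any two $\mathbb P$-generic branches $x,y$ over $M$, $$M[x]=M[y]\quad\Longleftrightarrow\quad x\,E_0\,y .$$ Then the isomorphic forcing $\widehat{\mathbb P}$ has a strictly increasing generic branch $c_x$ (corresponding to the $\mathbb P$-generic branch $x$) and satisfies $$M[c_x]=M[c_y]\quad\Longleftrightarrow\quad\bigl|\operatorname{ran}(c_x)\mathbin{\triangle}\operatorname{ran}(c_y)\bigr|<\omega$$ for all $\widehat{\mathbb P}$-generic branches $c_x,c_y$ over $M$.
   Context: For $x,y\in\omega^\omega$, $x\,E_0\,y$ means $x(n)=y(n)$ for all but finitely many $n$. $\triangle$ is symmetric difference. A tree forcing is a set of trees ordered by inclusion, such that each generic filter $G$ determines a unique branch lying in $[T]$ for all $T\in G$, called the generic branch; it generates the extension if $M[G]=M[x]$ for every generic filter $G$ over $M$ with generic branch $x$. For $x\in\omega^\omega$ define the sequence of ordinals $c_x(n)=\omega\cdot n+x(n)$ $(n<\omega)$, below $\omega^2$ (ordinal arithmetic). For $s\in\omega^{<\omega}$ let $\widehat s$ be the sequence of the same length with $\widehat s(i)=\omega\cdot i+s(i)$. For a tree $T\subseteq\omega^{<\omega}$ put $\widehat T=\{\widehat s:s\in T\}\subseteq(\omega^2)^{<\omega}$, and $\widehat{\mathbb P}=\{\widehat T:T\in\mathbb P\}$, ordered by inclusion; it is isomorphic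 to $\mathbb P$ via $T\mapsto\widehat T$. *)

theory Defs
  imports "HOL-Library.Countable_Set_Type"
begin

text \<open>
  Every element of a countable transitive set is hereditarily countable. The initial algebra of the
  countable powerset functor is the collection of all hereditarily countable sets, so it contains
  all countable transitive models together with their generic filters and generic extensions.
\<close>

datatype hc = HC (cset_of: "hc cset")

definition elts :: "hc \<Rightarrow> hc set" where
  "elts a = rcset (cset_of a)"

text \<open>Meaningful for countable \<open>A\<close> only; below it is applied to nothing else.\<close>

definition hcset :: "hc set \<Rightarrow> hc" where
  "hcset A = HC (acset A)"

lemma countable_elts [simp, intro]: "countable (elts a)"
  by (simp add: elts_def)

lemma elts_hcset [simp]: "countable A \<Longrightarrow> elts (hcset A) = A"
  by (simp add: elts_def hcset_def)

lemma elts_inject [simp]: "elts a = elts b \<longleftrightarrow> a = b"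
  by (metis elts_def hc.expand rcset_inject)

lemma hcset_elts [simp]: "hcset (elts a) = a"
  by (metis countable_elts elts_hcset elts_inject)

lemma hcset_inject: "countable A \<Longrightarrow> countable B \<Longrightarrow> hcset A = hcset B \<longleftrightarrow> A = B"
  by (metis elts_hcset)

lemma hc_induct:
  assumes "\<And>a. (\<And>b. b \<in> elts a \<Longrightarrow> P b) \<Longrightarrow> P a"
  shows "P a"
proof (induction a)
  case (HC A)
  show ?case
    by (rule assms, rule HC) (simp add: elts_def)
qed

lemma wf_elts: "wf {(b, a). b \<in> elts a}"
proof (rule wfUNIVI)
  fix P x
  assume step: "\<forall>x. (\<forall>y. (y, x) \<in> {(b, a). b \<in> elts a} \<longrightarrow> P y) \<longrightarrow> P x"
  show "P x"
  proof (rule hc_induct)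
    fix a
    assume "\<And>b. b \<in> elts a \<Longrightarrow> P b"
    then show "P a"
      using step[rule_format, of a] by simp
  qed
qed

definition pair :: "hc \<Rightarrow> hc \<Rightarrow> hc" where
  "pair a b = hcset {hcset {a}, hcset {a, b}}"

lemma pair_inject [simp]: "pair a b = pair c d \<longleftrightarrow> a = c \<and> b = d"
  by (auto simp: pair_def hcset_inject doubleton_eq_iff)

definition lam :: "hc \<Rightarrow> (hc \<Rightarrow> hc) \<Rightarrow> hc" where
  "lam a h = hcset ((\<lambda>i. pair i (h i)) ` elts a)"

definition funcs :: "hc \<Rightarrow> hc \<Rightarrow> hc set" where
  "funcs a b = {lam a h |h. \<forall>i\<in>elts a. h i \<in> elts b}"

definition dom_of :: "hc \<Rightarrow> hc set" where
  "dom_of f = {i. \<exists>j. pair i j \<in> elts f}"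

definition ran_of :: "hc \<Rightarrow> hc set" where
  "ran_of f = {j. \<exists>i. pair i j \<in> elts f}"

definition app :: "hc \<Rightarrow> hc \<Rightarrow> hc" where
  "app f i = (THE j. pair i j \<in> elts f)"

definition restr :: "hc \<Rightarrow> hc \<Rightarrow> hc" where
  "restr f a = hcset {p \<in> elts f. \<exists>i\<in>elts a. \<exists>j. p = pair i j}"

lemma elts_lam [simp]: "elts (lam a h) = (\<lambda>i. pair i (h i)) ` elts a"
  by (simp add: lam_def)

lemma elts_restr [simp]: "elts (restr f a) = {p \<in> elts f. \<exists>i\<in>elts a. \<exists>j. p = pair i j}"
  unfolding restr_def by (rule elts_hcset, rule countable_subset[OF _ countable_elts[of f]]) blast

lemma countable_dom_of [simp]: "countable (dom_of f)"
proof (rule countable_subset)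
  show "dom_of f \<subseteq> (\<lambda>p. THE i. \<exists>j. p = pair i j) ` elts f"
  proof
    fix i
    assume "i \<in> dom_of f"
    then obtain j where j: "pair i j \<in> elts f"
      by (auto simp: dom_of_def)
    have "i = (THE i'. \<exists>j'. pair i j = pair i' j')"
      by simp
    then show "i \<in> (\<lambda>p. THE i. \<exists>j. p = pair i j) ` elts f"
      using j by (rule image_eqI)
  qed
  show "countable ((\<lambda>p. THE i. \<exists>j. p = pair i j) ` elts f)"
    by simp
qed

lemma app_lam [simp]: "i \<in> elts a \<Longrightarrow> app (lam a h) i = h i"
  by (auto simp: app_def)

primrec ord_nat :: "nat \<Rightarrow> hc" where
  "ord_nat 0 = hcset {}"
| "ord_nat (Suc n) = hcset (insert (ord_nat n) (elts (ord_nat n)))"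

definition omega :: hc where
  "omega = hcset (range ord_nat)"

text \<open>
  On ordinals: \<open>a + b = a \<union> {a + c | c < b}\<close> and \<open>a \<cdot> b = {a \<cdot> c + d | c < b, d < a}\<close>.
  The recursive equations below are stated for sets in the form \<open>HC B\<close>; see the lemmas that follow.
\<close>

primrec oadd :: "hc \<Rightarrow> hc \<Rightarrow> hc" where
  "oadd a (HC B) = hcset (elts a \<union> rcset (cimage (oadd a) B))"

primrec omult :: "hc \<Rightarrow> hc \<Rightarrow> hc" where
  "omult a (HC B) = hcset (\<Union>e\<in>rcset (cimage (omult a) B). oadd e ` elts a)"

lemma elts_oadd: "elts (oadd a b) = elts a \<union> oadd a ` elts b"
  by (cases b) (simp add: elts_def[of "HC _"] cimage.rep_eq)

lemma elts_omult: "elts (omult a b) = (\<Union>c\<in>elts b. oadd (omult a c) ` elts a)"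
  by (cases b) (simp add: elts_def[of "HC _"] cimage.rep_eq)

datatype fm =
    Mem nat nat
  | Eq nat nat
  | Neg fm
  | Conj fm fm
  | Disj fm fm
  | Imp fm fm
  | Iff fm fm
  | All nat fm
  | Ex nat fm

primrec fv :: "fm \<Rightarrow> nat set" where
  "fv (Mem x y) = {x, y}"
| "fv (Eq x y) = {x, y}"
| "fv (Neg \<phi>) = fv \<phi>"
| "fv (Conj \<phi> \<psi>) = fv \<phi> \<union> fv \<psi>"
| "fv (Disj \<phi> \<psi>) = fv \<phi> \<union> fv \<psi>"
| "fv (Imp \<phi> \<psi>) = fv \<phi> \<union> fv \<psi>"
| "fv (Iff \<phi> \<psi>) = fv \<phi> \<union> fv \<psi>"
| "fv (All x \<phi>) = fv \<phi> - {x}"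
| "fv (Ex x \<phi>) = fv \<phi> - {x}"

primrec sat :: "hc set \<Rightarrow> (nat \<Rightarrow> hc) \<Rightarrow> fm \<Rightarrow> bool" where
  "sat M e (Mem x y) \<longleftrightarrow> e x \<in> elts (e y)"
| "sat M e (Eq x y) \<longleftrightarrow> e x = e y"
| "sat M e (Neg \<phi>) \<longleftrightarrow> \<not> sat M e \<phi>"
| "sat M e (Conj \<phi> \<psi>) \<longleftrightarrow> sat M e \<phi> \<and> sat M e \<psi>"
| "sat M e (Disj \<phi> \<psi>) \<longleftrightarrow> sat M e \<phi> \<or> sat M e \<psi>"
| "sat M e (Imp \<phi> \<psi>) \<longleftrightarrow> (sat M e \<phi> \<longrightarrow> sat M e \<psi>)"
| "sat M e (Iff \<phi> \<psi>) \<longleftrightarrow> (sat M e \<phi> \<longleftrightarrow> sat M e \<psi>)"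
| "sat M e (All x \<phi>) \<longleftrightarrow> (\<forall>a\<in>M. sat M (e(x := a)) \<phi>)"
| "sat M e (Ex x \<phi>) \<longleftrightarrow> (\<exists>a\<in>M. sat M (e(x := a)) \<phi>)"

text \<open>Axioms may have free variables; a model satisfies their universal closures.\<close>

definition models :: "hc set \<Rightarrow> fm set \<Rightarrow> bool" where
  "models M \<Phi> \<longleftrightarrow> M \<noteq> {} \<and> (\<forall>\<phi>\<in>\<Phi>. \<forall>e. range e \<subseteq> M \<longrightarrow> sat M e \<phi>)"

definition extensionality_ax :: fm where
  "extensionality_ax = Imp (All 2 (Iff (Mem 2 0) (Mem 2 1))) (Eq 0 1)"

definition foundation_ax :: fm where
  "foundation_ax =
    Imp (Ex 1 (Mem 1 0)) (Ex 1 (Conj (Mem 1 0) (Neg (Ex 2 (Conj (Mem 2 0) (Mem 2 1))))))"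

definition pairing_ax :: fm where
  "pairing_ax = Ex 2 (All 3 (Iff (Mem 3 2) (Disj (Eq 3 0) (Eq 3 1))))"

definition union_ax :: fm where
  "union_ax = Ex 1 (All 2 (Iff (Mem 2 1) (Ex 3 (Conj (Mem 3 0) (Mem 2 3)))))"

definition powerset_ax :: fm where
  "powerset_ax = Ex 1 (All 2 (Iff (Mem 2 1) (All 3 (Imp (Mem 3 2) (Mem 3 0)))))"

definition infinity_ax :: fm where
  "infinity_ax =
    Ex 0 (Conj
      (Ex 1 (Conj (Mem 1 0) (All 2 (Neg (Mem 2 1)))))
      (All 1 (Imp (Mem 1 0)
        (Ex 2 (Conj (Mem 2 0) (All 3 (Iff (Mem 3 2) (Disj (Mem 3 1) (Eq 3 1)))))))))"

text \<open>Every set of pairwise disjoint nonempty sets has a transversal.\<close>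

definition choice_ax :: fm where
  "choice_ax =
    Imp
      (Conj
        (All 1 (Imp (Mem 1 0) (Ex 2 (Mem 2 1))))
        (All 1 (All 2 (Imp
          (Conj (Conj (Mem 1 0) (Mem 2 0)) (Ex 3 (Conj (Mem 3 1) (Mem 3 2))))
          (Eq 1 2)))))
      (Ex 4 (All 1 (Imp (Mem 1 0)
        (Ex 2 (All 3 (Iff (Conj (Mem 3 4) (Mem 3 1)) (Eq 3 2)))))))"

text \<open>\<open>{x \<in> a | \<phi>}\<close> is a set \<open>b\<close>.\<close>

definition separation_ax :: "fm \<Rightarrow> nat \<Rightarrow> nat \<Rightarrow> nat \<Rightarrow> fm" where
  "separation_ax \<phi> x a b = Ex b (All x (Iff (Mem x b) (Conj (Mem x a) \<phi>)))"

text \<open>If \<open>\<phi>\<close> defines a function \<open>x \<mapsto> y\<close> on \<open>a\<close>, then its values lie in a set \<open>b\<close>.\<close>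

definition replacement_ax :: "fm \<Rightarrow> nat \<Rightarrow> nat \<Rightarrow> nat \<Rightarrow> nat \<Rightarrow> nat \<Rightarrow> fm" where
  "replacement_ax \<phi> x y z a b =
    Imp (All x (Imp (Mem x a) (Ex z (All y (Iff \<phi> (Eq y z))))))
        (Ex b (All x (Imp (Mem x a) (Ex y (Conj (Mem y b) \<phi>)))))"

definition ZFC :: "fm set" where
  "ZFC =
    {extensionality_ax, foundation_ax, pairing_ax, union_ax, powerset_ax, infinity_ax, choice_ax}
    \<union> {separation_ax \<phi> x a b |\<phi> x a b. distinct [x, a, b] \<and> b \<notin> fv \<phi>}
    \<union> {replacement_ax \<phi> x y z a b |\<phi> x y z a b.
         distinct [x, y, z, a, b] \<and> z \<notin> fv \<phi> \<and> b \<notin> fv \<phi>}"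

definition transitive :: "hc set \<Rightarrow> bool" where
  "transitive M \<longleftrightarrow> (\<forall>a\<in>M. elts a \<subseteq> M)"

definition ctm :: "fm set \<Rightarrow> hc set \<Rightarrow> bool" where
  "ctm \<Phi> M \<longleftrightarrow> countable M \<and> transitive M \<and> models M \<Phi>"

text \<open>
  \<open>M[x]\<close>: the least transitive model of the theory \<open>\<Psi>\<close> that includes \<open>M\<close> and contains \<open>x\<close>.
  If \<open>M\<close> is a model of ZFC and \<open>x\<close> lies in a generic extension of \<open>M\<close>, then, with \<open>\<Psi> = ZFC\<close>, the
  intersection below is itself such a model. For a finite theory \<open>\<Psi>\<close>, the same holds if \<open>\<Psi>\<close> is
  large enough and \<open>M\<close> satisfies a fragment large enough to prove that its generic extensions and
  the intermediate models \<open>M[x]\<close> satisfy \<open>\<Psi>\<close>; this is why the theory \<open>\<Phi>\<close> of the ground model and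
  the theory \<open>\<Psi>\<close> of the extensions are kept apart.
\<close>

definition adjoin :: "fm set \<Rightarrow> hc set \<Rightarrow> hc \<Rightarrow> hc set" where
  "adjoin \<Psi> M x = \<Inter>{N. transitive N \<and> models N \<Psi> \<and> M \<subseteq> N \<and> x \<in> N}"

definition filter_on :: "hc \<Rightarrow> hc set \<Rightarrow> bool" where
  "filter_on P G \<longleftrightarrow>
    G \<subseteq> elts P \<and> G \<noteq> {} \<and>
    (\<forall>p\<in>G. \<forall>q\<in>elts P. elts p \<subseteq> elts q \<longrightarrow> q \<in> G) \<and>
    (\<forall>p\<in>G. \<forall>q\<in>G. \<exists>r\<in>G. elts r \<subseteq> elts p \<and> elts r \<subseteq> elts q)"

definition dense_in :: "hc \<Rightarrow> hc set \<Rightarrow> bool" where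
  "dense_in P D \<longleftrightarrow> D \<subseteq> elts P \<and> (\<forall>p\<in>elts P. \<exists>d\<in>D. elts d \<subseteq> elts p)"

definition generic :: "hc set \<Rightarrow> hc \<Rightarrow> hc set \<Rightarrow> bool" where
  "generic M P G \<longleftrightarrow>
    filter_on P G \<and> (\<forall>D\<in>M. dense_in P (elts D) \<longrightarrow> G \<inter> elts D \<noteq> {})"

inductive is_name :: "hc \<Rightarrow> hc \<Rightarrow> bool" for P where
  "(\<forall>z\<in>elts t. \<exists>s p. z = pair s p \<and> p \<in> elts P \<and> is_name P s) \<Longrightarrow> is_name P t"

lemma wf_in_dom: "wf {(s, t). \<exists>p. pair s p \<in> elts t}"
proof (rule wf_subset[OF wf_trancl[OF wf_elts]], clarify)
  fix s t p
  assume *: "pair s p \<in> elts t"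
  have "(s, hcset {s}) \<in> {(b, a). b \<in> elts a}" "(hcset {s}, pair s p) \<in> {(b, a). b \<in> elts a}"
    by (auto simp: pair_def)
  moreover from * have "(pair s p, t) \<in> {(b, a). b \<in> elts a}"
    by simp
  ultimately show "(s, t) \<in> {(b, a). b \<in> elts a}\<^sup>+"
    by (meson r_into_trancl trancl_into_trancl)
qed

text \<open>The evaluation \<open>{val G s | (s, p) \<in> t, p \<in> G}\<close> of the name \<open>t\<close>.\<close>

function val :: "hc set \<Rightarrow> hc \<Rightarrow> hc" where
  "val G t = hcset (val G ` {s. \<exists>p\<in>G. pair s p \<in> elts t})"
  by auto
termination
  by (relation "inv_image {(s, t). \<exists>p. pair s p \<in> elts t} snd") (auto intro: wf_in_dom)

declare val.simps [simp del]

lemma elts_val: "elts (val G t) = {val G s |s p. p \<in> G \<and> pair s p \<in> elts t}"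
proof -
  have "{s. \<exists>p\<in>G. pair s p \<in> elts t} \<subseteq> dom_of t"
    by (auto simp: dom_of_def)
  then have "countable (val G ` {s. \<exists>p\<in>G. pair s p \<in> elts t})"
    by (intro countable_image countable_subset[OF _ countable_dom_of])
  then show ?thesis
    by (subst val.simps) auto
qed

definition gen_ext :: "hc set \<Rightarrow> hc \<Rightarrow> hc set \<Rightarrow> hc set" where
  "gen_ext M P G = val G ` {t \<in> M. is_name P t}"

definition seqs :: "hc \<Rightarrow> hc set" where
  "seqs A = (\<Union>n\<in>elts omega. funcs n A)"

definition tree_on :: "hc \<Rightarrow> hc \<Rightarrow> bool" where
  "tree_on A T \<longleftrightarrow> elts T \<subseteq> seqs A \<and> (\<forall>s\<in>elts T. \<forall>n\<in>elts omega. restr s n \<in> elts T)"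

definition branches :: "hc \<Rightarrow> hc \<Rightarrow> hc set" where
  "branches A T = {x \<in> funcs omega A. \<forall>n\<in>elts omega. restr x n \<in> elts T}"

definition branch_of :: "hc \<Rightarrow> hc set \<Rightarrow> hc \<Rightarrow> bool" where
  "branch_of A G x \<longleftrightarrow> x \<in> funcs omega A \<and> (\<forall>T\<in>G. x \<in> branches A T)"

definition tree_forcing :: "hc set \<Rightarrow> hc \<Rightarrow> hc \<Rightarrow> bool" where
  "tree_forcing M A P \<longleftrightarrow>
    P \<in> M \<and> (\<forall>T\<in>elts P. tree_on A T) \<and> (\<forall>G. generic M P G \<longrightarrow> (\<exists>!x. branch_of A G x))"

definition generic_branch :: "hc set \<Rightarrow> hc \<Rightarrow> hc \<Rightarrow> hc \<Rightarrow> bool" where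
  "generic_branch M A P x \<longleftrightarrow> (\<exists>G. generic M P G \<and> branch_of A G x)"

definition generates_extension :: "fm set \<Rightarrow> hc set \<Rightarrow> hc \<Rightarrow> hc \<Rightarrow> bool" where
  "generates_extension \<Psi> M A P \<longleftrightarrow>
    (\<forall>G x. generic M P G \<and> branch_of A G x \<longrightarrow> gen_ext M P G = adjoin \<Psi> M x)"

definition E0 :: "hc \<Rightarrow> hc \<Rightarrow> bool" where
  "E0 x y \<longleftrightarrow> finite {n \<in> elts omega. app x n \<noteq> app y n}"

text \<open>
  The map \<open>f \<mapsto> (i \<mapsto> \<omega> \<cdot> i + f i)\<close>, both on finite sequences (where \<open>s\<close> is sent to \<open>s\<close> with a hat) and
  on infinite ones (\<open>x \<mapsto> c\<^sub>x\<close>).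
\<close>

definition hat :: "hc \<Rightarrow> hc" where
  "hat f = lam (hcset (dom_of f)) (\<lambda>i. oadd (omult omega i) (app f i))"

definition hat_tree :: "hc \<Rightarrow> hc" where
  "hat_tree T = hcset (hat ` elts T)"

definition hat_forcing :: "hc \<Rightarrow> hc" where
  "hat_forcing P = hcset (hat_tree ` elts P)"

definition strictly_increasing :: "hc \<Rightarrow> bool" where
  "strictly_increasing c \<longleftrightarrow>
    (\<forall>i\<in>elts omega. \<forall>j\<in>elts omega. i \<in> elts j \<longrightarrow> app c i \<in> elts (app c j))"

end

theory Submission
  imports Defs
begin

text \<open>
  The coding map sends a sequence \<open>s\<close> to \<open>i \<mapsto> \<omega> \<cdot> i + s i\<close>. It only puts the \<open>i\<close>-th value into a block
  of its own, namely the ordinals from \<open>\<omega> \<cdot> i\<close> up to, but excluding, \<open>\<omega> \<cdot> (i + 1)\<close>. The blocks follow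
  each other, so coded branches increase strictly; the blocks are disjoint, so the map is injective
  and two coded branches have ranges with finite symmetric difference exactly if the branches agree
  almost everywhere (\<open>finite_ran_hat_iff_E0\<close>). Consequently the theorem reduces to two facts:
  \<open>x\<close> and its code generate the same model (\<open>adjoin_hat\<close>), and the generic filters of the two
  forcings correspond to each other (\<open>generic_hat\<close>, \<open>generic_hatE\<close>), with coded branches as
  generic branches (\<open>branch_of_hat_iff\<close>).

  Both facts hold because the coding map can be computed in every transitive model of a suitable
  finite part of ZFC. On sequences it is the image under the set \<open>hat_table\<close> of all pairs
  \<open>((i, m), (i, \<omega> \<cdot> i + m))\<close>, and decoding is the image under the converse set \<open>unhat_table\<close>. Once these
  two sets lie in a model, image formation, by separation and replacement, yields the codes of
  sequences, trees and sets of trees and their decodings (\<open>ZFC_ensures_hat_closed\<close>). In particular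
  the coded forcing and the translations of dense sets in either direction belong to the ground
  model.

  The models are only known to be transitive, so the table has to be built inside each of them:
  \<open>y = \<omega> \<cdot> n + m\<close> is definable by the existence of a finite set of triples that records a computation
  of \<open>y\<close> by successor steps and steps to the next block. Finite subsets of a model belong to it, so
  external induction shows that these witnesses exist, and replacement collects the values.
\<close>

section \<open>Consequences of finite fragments of ZFC in transitive models\<close>

text \<open>
  Which axioms a closure property needs is left implicit: a property is ensured if some finite set
  of axioms yields it. Since two finite sets can be merged, closure properties can be derived from
  one another, and only the last of them is turned into an actual finite subset of ZFC.
\<close>

definition ZFC_ensures :: "(hc set \<Rightarrow> bool) \<Rightarrow> bool" where
  "ZFC_ensures C \<longleftrightarrow>
    (\<exists>\<Phi>. finite \<Phi> \<and> \<Phi> \<subseteq> ZFC \<and> (\<forall>N. transitive N \<and> models N \<Phi> \<longrightarrow> C N))"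

lemma models_antimono: "models N \<Psi> \<Longrightarrow> \<Phi> \<subseteq> \<Psi> \<Longrightarrow> models N \<Phi>"
  by (auto simp: models_def)

lemma ZFC_ensures_mono:
  assumes "ZFC_ensures C" and "\<And>N. transitive N \<Longrightarrow> C N \<Longrightarrow> D N"
  shows "ZFC_ensures D"
  using assms unfolding ZFC_ensures_def by meson

lemma ZFC_ensures_conj:
  assumes "ZFC_ensures C" and "ZFC_ensures D"
  shows "ZFC_ensures (\<lambda>N. C N \<and> D N)"
proof -
  from assms obtain \<Phi> \<Psi> where
    "finite \<Phi>" "\<Phi> \<subseteq> ZFC" "\<forall>N. transitive N \<and> models N \<Phi> \<longrightarrow> C N"
    "finite \<Psi>" "\<Psi> \<subseteq> ZFC" "\<forall>N. transitive N \<and> models N \<Psi> \<longrightarrow> D N"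
    unfolding ZFC_ensures_def by blast
  then show ?thesis
    unfolding ZFC_ensures_def
    by (intro exI[of _ "\<Phi> \<union> \<Psi>"]) (auto intro: models_antimono)
qed

lemma ZFC_ensures_axiom:
  assumes "\<phi> \<in> ZFC"
  shows "ZFC_ensures (\<lambda>N. N \<noteq> {} \<and> (\<forall>e. range e \<subseteq> N \<longrightarrow> sat N e \<phi>))"
  unfolding ZFC_ensures_def using assms by (intro exI[of _ "{\<phi>}"]) (auto simp: models_def)

text \<open>
  One formula has to work for all transitive sets \<open>N\<close>. An absolute relation ignores the argument \<open>N\<close>;
  the others quantify over it. Definability of each notion is proved for arbitrary variables, so that
  notions can be combined without substitution into formulas.
\<close>

definition definable :: "(hc set \<Rightarrow> (nat \<Rightarrow> hc) \<Rightarrow> bool) \<Rightarrow> bool" where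
  "definable R \<longleftrightarrow>
    (\<exists>\<phi>. \<forall>N e. transitive N \<longrightarrow> range e \<subseteq> N \<longrightarrow> (sat N e \<phi> \<longleftrightarrow> R N e))"

lemma definable_cong:
  assumes "definable R"
    and "\<And>N e. transitive N \<Longrightarrow> range e \<subseteq> N \<Longrightarrow> R N e \<longleftrightarrow> S N e"
  shows "definable S"
  using assms unfolding definable_def by meson

lemma definable_mem: "definable (\<lambda>N e. e x \<in> elts (e y))"
  unfolding definable_def by (rule exI[of _ "Mem x y"]) simp

lemma definable_eq: "definable (\<lambda>N e. e x = e y)"
  unfolding definable_def by (rule exI[of _ "Eq x y"]) simp

lemma definable_not: "definable R \<Longrightarrow> definable (\<lambda>N e. \<not> R N e)"
  unfolding definable_def by (metis sat.simps(3))

lemma definable_conj: "definable R \<Longrightarrow> definable S \<Longrightarrow> definable (\<lambda>N e. R N e \<and> S N e)"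
  unfolding definable_def by (metis sat.simps(4))

lemma definable_disj: "definable R \<Longrightarrow> definable S \<Longrightarrow> definable (\<lambda>N e. R N e \<or> S N e)"
  unfolding definable_def by (metis sat.simps(5))

lemma definable_imp: "definable R \<Longrightarrow> definable S \<Longrightarrow> definable (\<lambda>N e. R N e \<longrightarrow> S N e)"
  unfolding definable_def by (metis sat.simps(6))

lemma definable_iff: "definable R \<Longrightarrow> definable S \<Longrightarrow> definable (\<lambda>N e. R N e \<longleftrightarrow> S N e)"
  unfolding definable_def by (metis sat.simps(7))

text \<open>
  The bound variable must be fresh for the variables \<open>V\<close> on which the relation depends; the last
  assumption expresses this dependence semantically.
\<close>

lemma definable_ex:
  assumes "finite V"
    and "\<And>z. z \<notin> V \<Longrightarrow> definable (\<lambda>N e. R N e (e z))"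
    and "\<And>N e z a b. z \<notin> V \<Longrightarrow> R N (e(z := b)) a \<longleftrightarrow> R N e a"
  shows "definable (\<lambda>N e. \<exists>a\<in>N. R N e a)"
proof -
  obtain z where z: "z \<notin> V"
    using assms(1) ex_new_if_finite infinite_UNIV_nat by blast
  with assms(2) obtain \<phi> where
    \<phi>: "\<And>N e. transitive N \<Longrightarrow> range e \<subseteq> N \<Longrightarrow> sat N e \<phi> \<longleftrightarrow> R N e (e z)"
    unfolding definable_def by blast
  have "sat N e (Ex z \<phi>) \<longleftrightarrow> (\<exists>a\<in>N. R N e a)" if "transitive N" "range e \<subseteq> N" for N e
  proof -
    have "sat N (e(z := a)) \<phi> \<longleftrightarrow> R N e a" if "a \<in> N" for a
      using \<phi>[of N "e(z := a)"] \<open>transitive N\<close> \<open>range e \<subseteq> N\<close> that assms(3)[OF z, of N e a a]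
      by auto
    then show ?thesis
      by simp
  qed
  then show ?thesis
    unfolding definable_def by blast
qed

lemma definable_all:
  assumes "finite V"
    and "\<And>z. z \<notin> V \<Longrightarrow> definable (\<lambda>N e. R N e (e z))"
    and "\<And>N e z a b. z \<notin> V \<Longrightarrow> R N (e(z := b)) a \<longleftrightarrow> R N e a"
  shows "definable (\<lambda>N e. \<forall>a\<in>N. R N e a)"
proof -
  have "definable (\<lambda>N e. \<not> (\<exists>a\<in>N. \<not> R N e a))"
    by (intro definable_not definable_ex[OF assms(1)]) (auto simp: assms(2,3))
  then show ?thesis
    by simp
qed

lemma finite_fv: "finite (fv \<phi>)"
  by (induction \<phi>) auto

lemma transitiveD: "transitive N \<Longrightarrow> a \<in> N \<Longrightarrow> b \<in> elts a \<Longrightarrow> b \<in> N"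
  by (auto simp: transitive_def)

lemma elts_separate [simp]: "elts (hcset {z \<in> elts A. Q z}) = {z \<in> elts A. Q z}"
  by (rule elts_hcset, rule countable_subset[OF _ countable_elts[of A]]) blast

lemma separation_in_ZFC:
  "distinct [x, a, b] \<Longrightarrow> b \<notin> fv \<phi> \<Longrightarrow> separation_ax \<phi> x a b \<in> ZFC"
  unfolding ZFC_def by (rule UnI1, rule UnI2, rule CollectI) blast

lemma replacement_in_ZFC:
  "distinct [x, y, z, a, b] \<Longrightarrow> z \<notin> fv \<phi> \<Longrightarrow> b \<notin> fv \<phi> \<Longrightarrow> replacement_ax \<phi> x y z a b \<in> ZFC"
  unfolding ZFC_def by (rule UnI2, rule CollectI) blast

text \<open>
  Separation with two parameters. The set variables of the axiom are chosen fresh for the formula,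
  so changing their values does not disturb the relation that the formula defines.
\<close>

lemma ZFC_ensures_separation:
  assumes "definable (\<lambda>N e. R N (e 0) (e 1) (e 2))"
  shows "ZFC_ensures (\<lambda>N. \<forall>A\<in>N. \<forall>p\<in>N. \<forall>q\<in>N. hcset {z \<in> elts A. R N z p q} \<in> N)"
proof -
  from assms obtain \<phi> where
    \<phi>: "\<And>N e. transitive N \<Longrightarrow> range e \<subseteq> N \<Longrightarrow> sat N e \<phi> \<longleftrightarrow> R N (e 0) (e 1) (e 2)"
    unfolding definable_def by blast
  obtain a where a: "a \<notin> fv \<phi> \<union> {0, 1, 2}"
    using ex_new_if_finite[OF infinite_UNIV_nat, of "fv \<phi> \<union> {0, 1, 2}"] finite_fv by auto
  obtain b where b: "b \<notin> fv \<phi> \<union> {0, 1, 2, a}"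
    using ex_new_if_finite[OF infinite_UNIV_nat, of "fv \<phi> \<union> {0, 1, 2, a}"] finite_fv by auto
  have ax: "separation_ax \<phi> 0 a b \<in> ZFC"
    by (rule separation_in_ZFC) (use a b in auto)
  show ?thesis
  proof (rule ZFC_ensures_mono[OF ZFC_ensures_axiom[OF ax]], intro ballI)
    fix N A p q
    assume N: "transitive N"
      and ax: "N \<noteq> {} \<and> (\<forall>e. range e \<subseteq> N \<longrightarrow> sat N e (separation_ax \<phi> 0 a b))"
      and in_N: "A \<in> N" "p \<in> N" "q \<in> N"
    define e where "e = (\<lambda>_::nat. A)(1 := p, 2 := q)"
    have e: "range e \<subseteq> N"
      using in_N by (auto simp: e_def)
    with ax have "sat N e (separation_ax \<phi> 0 a b)"
      by blast
    moreover have "(e(b := B, 0 := z)) a = A" "(e(b := B, 0 := z)) b = B" for B z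
      using a b by (auto simp: e_def)
    ultimately obtain B where B: "B \<in> N"
      and *: "\<And>z. z \<in> N \<Longrightarrow> z \<in> elts B \<longleftrightarrow> z \<in> elts A \<and> sat N (e(b := B, 0 := z)) \<phi>"
      unfolding separation_ax_def by (auto simp del: fun_upd_apply simp: fun_upd_same)
    have "sat N (e(b := B, 0 := z)) \<phi> \<longleftrightarrow> R N z p q" if "z \<in> N" for z
      using \<phi>[OF N, of "e(b := B, 0 := z)"] e B that b by (auto simp: e_def split: if_splits)
    with * have "z \<in> elts B \<longleftrightarrow> z \<in> elts A \<and> R N z p q" for z
      using transitiveD[OF N \<open>A \<in> N\<close>] transitiveD[OF N B] by blast
    then have "{z \<in> elts A. R N z p q} = elts B"
      by blast
    with B show "hcset {z \<in> elts A. R N z p q} \<in> N"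
      by simp
  qed
qed

text \<open>
  The axiom only provides a set that covers the range of the class function; an instance of
  separation cuts it down to the range itself.
\<close>

lemma ZFC_ensures_replacement:
  assumes def: "\<And>x y z. definable (\<lambda>N e. R N (e x) (e y) (e z))"
  shows "ZFC_ensures (\<lambda>N. \<forall>A\<in>N. \<forall>p\<in>N. \<forall>h.
    (\<forall>z\<in>elts A. h z \<in> N \<and> (\<forall>v\<in>N. R N z v p \<longleftrightarrow> v = h z)) \<longrightarrow> hcset (h ` elts A) \<in> N)"
proof -
  from def[of 0 1 2] obtain \<phi> where
    \<phi>: "\<And>N e. transitive N \<Longrightarrow> range e \<subseteq> N \<Longrightarrow> sat N e \<phi> \<longleftrightarrow> R N (e 0) (e 1) (e 2)"
    unfolding definable_def by blast
  obtain w where w: "w \<notin> fv \<phi> \<union> {0, 1, 2}"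
    using ex_new_if_finite[OF infinite_UNIV_nat, of "fv \<phi> \<union> {0, 1, 2}"] finite_fv by auto
  obtain a where a: "a \<notin> fv \<phi> \<union> {0, 1, 2, w}"
    using ex_new_if_finite[OF infinite_UNIV_nat, of "fv \<phi> \<union> {0, 1, 2, w}"] finite_fv by auto
  obtain b where b: "b \<notin> fv \<phi> \<union> {0, 1, 2, w, a}"
    using ex_new_if_finite[OF infinite_UNIV_nat, of "fv \<phi> \<union> {0, 1, 2, w, a}"] finite_fv by auto
  have ax: "replacement_ax \<phi> 0 1 w a b \<in> ZFC"
    by (rule replacement_in_ZFC) (use w a b in auto)
  have image: "definable (\<lambda>N e. \<exists>z\<in>N. z \<in> elts (e 1) \<and> R N z (e 0) (e 2))"
    by (rule definable_ex[where V = "{0, 1, 2}"]) (auto intro!: definable_conj definable_mem def)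
  show ?thesis
  proof (rule ZFC_ensures_mono[OF ZFC_ensures_conj[OF ZFC_ensures_axiom[OF ax]
          ZFC_ensures_separation[OF image]]], intro ballI allI impI)
    fix N A p h
    assume N: "transitive N"
      and ensured: "(N \<noteq> {} \<and> (\<forall>e. range e \<subseteq> N \<longrightarrow> sat N e (replacement_ax \<phi> 0 1 w a b))) \<and>
        (\<forall>B\<in>N. \<forall>A\<in>N. \<forall>p\<in>N. hcset {v \<in> elts B. \<exists>z\<in>N. z \<in> elts A \<and> R N z v p} \<in> N)"
      and in_N: "A \<in> N" "p \<in> N"
      and h: "\<forall>z\<in>elts A. h z \<in> N \<and> (\<forall>v\<in>N. R N z v p \<longleftrightarrow> v = h z)"
    define e where "e = (\<lambda>_::nat. A)(2 := p)"
    have e: "range e \<subseteq> N"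
      using in_N by (auto simp: e_def)
    have \<phi>': "sat N (e(w := u, 0 := z, 1 := v)) \<phi> \<longleftrightarrow> v = h z"
        "sat N (e(b := u, 0 := z, 1 := v)) \<phi> \<longleftrightarrow> v = h z"
      if "u \<in> N" "z \<in> elts A" "v \<in> N" for u z v
    proof -
      have "z \<in> N"
        using transitiveD N in_N that by blast
      then show "sat N (e(w := u, 0 := z, 1 := v)) \<phi> \<longleftrightarrow> v = h z"
        using \<phi>[OF N, of "e(w := u, 0 := z, 1 := v)"] e that w h 
        by (auto simp: e_def split: if_splits)
      show "sat N (e(b := u, 0 := z, 1 := v)) \<phi> \<longleftrightarrow> v = h z"
        using \<phi>[OF N, of "e(b := u, 0 := z, 1 := v)"] e that b h \<open>z \<in> N\<close>
        by (auto simp: e_def split: if_splits)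
    qed
    have "sat N e (replacement_ax \<phi> 0 1 w a b)"
      using ensured e by blast
    moreover have "sat N e (All 0 (Imp (Mem 0 a) (Ex w (All 1 (Iff \<phi> (Eq 1 w))))))"
    proof -
      have "\<exists>u\<in>N. \<forall>v\<in>N. sat N (e(0 := z, w := u, 1 := v)) \<phi> \<longleftrightarrow> v = u" if "z \<in> elts A" for z
        using \<phi>'(1)[OF _ that] h that w by (auto simp: fun_upd_twist intro!: bexI[of _ "h z"])
      then show ?thesis
        using w a by (auto simp: e_def)
    qed
    ultimately have "sat N e (Ex b (All 0 (Imp (Mem 0 a) (Ex 1 (Conj (Mem 1 b) \<phi>)))))"
      unfolding replacement_ax_def by simp
    then obtain B where B: "B \<in> N"
      and *: "\<And>z. z \<in> N \<Longrightarrow> z \<in> elts A \<Longrightarrow> \<exists>v\<in>N. v \<in> elts B \<and> sat N (e(b := B, 0 := z, 1 := v)) \<phi>"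
      using a b by (auto simp: e_def)
    have "h z \<in> elts B" if "z \<in> elts A" for z
      using *[OF transitiveD[OF N in_N(1) that] that] \<phi>'(2)[OF B that] by auto
    then have "h ` elts A = {v \<in> elts B. \<exists>z\<in>N. z \<in> elts A \<and> R N z v p}"
      using h transitiveD[OF N in_N(1)] transitiveD[OF N B] by (auto simp: image_iff)
    then show "hcset (h ` elts A) \<in> N"
      using ensured B in_N by auto
  qed
qed

section \<open>Definability of pairing and successor\<close>

definition osucc :: "hc \<Rightarrow> hc" where
  "osucc a = hcset (insert a (elts a))"

lemma elts_osucc [simp]: "elts (osucc a) = insert a (elts a)"
  by (simp add: osucc_def)

lemma hc_eqI: "(\<And>w. w \<in> elts a \<longleftrightarrow> w \<in> elts b) \<Longrightarrow> a = b"
  using elts_inject by blast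

text \<open>
  Equality with an explicitly given set is absolute: extensionality may be tested inside \<open>N\<close>. This
  is how equations with set operations become definable.
\<close>

lemma eq_hcset_iff_in_transitive:
  assumes "transitive N" "a \<in> N" "A \<subseteq> N" "countable A"
  shows "a = hcset A \<longleftrightarrow> (\<forall>w\<in>N. w \<in> elts a \<longleftrightarrow> w \<in> A)"
proof
  assume *: "\<forall>w\<in>N. w \<in> elts a \<longleftrightarrow> w \<in> A"
  have "elts a = A"
    using * transitiveD[OF assms(1,2)] assms(3) by blast
  then show "a = hcset A"
    by auto
qed (simp add: assms(4))

lemma definable_upair: "definable (\<lambda>N e. e z = hcset {e x, e y})"
proof (rule definable_cong)
  show "definable (\<lambda>N e. \<forall>w\<in>N. w \<in> elts (e z) \<longleftrightarrow> w = e x \<or> w = e y)"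
    by (rule definable_all[where V = "{x, y, z}"])
      (auto intro!: definable_iff definable_disj definable_mem definable_eq)
  fix N and e :: "nat \<Rightarrow> hc"
  assume "transitive N" "range e \<subseteq> N"
  then show "(\<forall>w\<in>N. w \<in> elts (e z) \<longleftrightarrow> w = e x \<or> w = e y) \<longleftrightarrow> e z = hcset {e x, e y}"
    by (subst eq_hcset_iff_in_transitive[of N]) auto
qed

lemma definable_singleton: "definable (\<lambda>N e. e z = hcset {e x})"
  using definable_upair[of z x x] by simp

lemma definable_empty: "definable (\<lambda>N e. e x = hcset {})"
proof (rule definable_cong)
  show "definable (\<lambda>N e. \<forall>w\<in>N. w \<notin> elts (e x))"
    by (rule definable_all[where V = "{x}"]) (auto intro!: definable_not definable_mem)
  fix N and e :: "nat \<Rightarrow> hc"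
  assume "transitive N" "range e \<subseteq> N"
  then show "(\<forall>w\<in>N. w \<notin> elts (e x)) \<longleftrightarrow> e x = hcset {}"
    by (subst eq_hcset_iff_in_transitive[of N]) auto
qed

lemma definable_osucc: "definable (\<lambda>N e. e y = osucc (e x))"
proof (rule definable_cong)
  show "definable (\<lambda>N e. \<forall>w\<in>N. w \<in> elts (e y) \<longleftrightarrow> w = e x \<or> w \<in> elts (e x))"
    by (rule definable_all[where V = "{x, y}"])
      (auto intro!: definable_iff definable_disj definable_mem definable_eq)
  fix N and e :: "nat \<Rightarrow> hc"
  assume "transitive N" "range e \<subseteq> N"
  then show "(\<forall>w\<in>N. w \<in> elts (e y) \<longleftrightarrow> w = e x \<or> w \<in> elts (e x)) \<longleftrightarrow> e y = osucc (e x)"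
    unfolding osucc_def by (subst eq_hcset_iff_in_transitive[of N]) (auto dest: transitiveD)
qed

lemma pair_in_transitive:
  assumes "transitive N" "pair a b \<in> N"
  shows "a \<in> N" "b \<in> N" "hcset {a, b} \<in> N" "hcset {a} \<in> N"
proof -
  show "hcset {a, b} \<in> N" "hcset {a} \<in> N"
    using transitiveD[OF assms] by (auto simp: pair_def)
  then show "a \<in> N" "b \<in> N"
    using transitiveD[OF assms(1)] by fastforce+
qed

lemma definable_pair: "definable (\<lambda>N e. e z = pair (e x) (e y))"
proof (rule definable_cong)
  show "definable (\<lambda>N e. \<exists>u\<in>N. \<exists>v\<in>N.
      u = hcset {e x} \<and> v = hcset {e x, e y} \<and> e z = hcset {u, v})"
    apply (rule definable_ex[where V = "{x, y, z}"], simp)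
    subgoal for u
      by (rule definable_ex[where V = "{x, y, z, u}"])
        (auto intro!: definable_conj definable_upair definable_singleton)
    by auto
  fix N and e :: "nat \<Rightarrow> hc"
  assume N: "transitive N" "range e \<subseteq> N"
  show "(\<exists>u\<in>N. \<exists>v\<in>N. u = hcset {e x} \<and> v = hcset {e x, e y} \<and> e z = hcset {u, v}) \<longleftrightarrow>
      e z = pair (e x) (e y)"
    using N(2) pair_in_transitive(3,4)[OF N(1), of "e x" "e y"]
    by (metis pair_def range_subsetD)
qed

section \<open>The natural numbers\<close>

abbreviation zero :: hc where
  "zero \<equiv> hcset {}"

lemma ord_nat_Suc: "ord_nat (Suc n) = osucc (ord_nat n)"
  by (simp add: osucc_def)

declare ord_nat.simps(2) [simp del]

lemma elts_ord_nat: "elts (ord_nat n) = ord_nat ` {..<n}"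
  by (induction n) (auto simp: ord_nat_Suc lessThan_Suc)

lemma elts_omega: "elts omega = range ord_nat"
  by (simp add: omega_def)

lemma mem_irrefl [simp]: "a \<notin> elts a"
  using wf_not_refl[OF wf_elts, of a] by simp

lemma mem_asym: "a \<in> elts b \<Longrightarrow> b \<notin> elts a"
  using wf_not_sym[OF wf_elts, of a b] by simp

lemma ord_nat_mem_iff [simp]: "ord_nat i \<in> elts (ord_nat j) \<longleftrightarrow> i < j"
  by (metis elts_ord_nat image_eqI lessThan_iff linorder_neqE_nat mem_asym mem_irrefl)

lemma ord_nat_inject [simp]: "ord_nat i = ord_nat j \<longleftrightarrow> i = j"
  by (metis linorder_neqE_nat mem_irrefl ord_nat_mem_iff)

definition zero_or_succ :: "hc \<Rightarrow> bool" where
  "zero_or_succ w \<longleftrightarrow> w = zero \<or> (\<exists>v\<in>elts w. w = osucc v)"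

lemma definable_zero_or_succ: "definable (\<lambda>N e. zero_or_succ (e w))"
proof (rule definable_cong)
  show "definable (\<lambda>N e. e w = zero \<or> (\<exists>v\<in>N. v \<in> elts (e w) \<and> e w = osucc v))"
    by (rule definable_disj[OF definable_empty], rule definable_ex[where V = "{w}"])
      (auto intro!: definable_conj definable_mem definable_osucc)
  fix N and e :: "nat \<Rightarrow> hc"
  assume "transitive N" "range e \<subseteq> N"
  then show "(e w = zero \<or> (\<exists>v\<in>N. v \<in> elts (e w) \<and> e w = osucc v)) \<longleftrightarrow> zero_or_succ (e w)"
    unfolding zero_or_succ_def by (meson range_subsetD transitiveD)
qed

text \<open>
  A definition by bounded quantifiers, hence absolute. By foundation, the descent from a successor to
  its predecessor stops, and it can only stop at zero.
\<close>

lemma omega_iff: "z \<in> elts omega \<longleftrightarrow> zero_or_succ z \<and> (\<forall>w\<in>elts z. zero_or_succ w)"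
proof
  have "zero_or_succ (ord_nat n)" for n
    by (cases n) (simp_all add: zero_or_succ_def ord_nat_Suc)
  then show "z \<in> elts omega \<Longrightarrow> zero_or_succ z \<and> (\<forall>w\<in>elts z. zero_or_succ w)"
    by (auto simp: elts_omega elts_ord_nat)
next
  show "zero_or_succ z \<and> (\<forall>w\<in>elts z. zero_or_succ w) \<Longrightarrow> z \<in> elts omega"
  proof (induction z rule: hc_induct)
    case (1 z)
    show ?case
    proof (cases "z = zero")
      case True
      then have "z = ord_nat 0"
        by simp
      then show ?thesis
        unfolding elts_omega by blast
    next
      case False
      with 1 obtain v where v: "v \<in> elts z" "z = osucc v"
        by (auto simp: zero_or_succ_def)
      with 1 have "v \<in> elts omega"
        by auto
      then obtain n where "z = ord_nat (Suc n)"
        using v ord_nat_Suc by (auto simp: elts_omega)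
      then show ?thesis
        unfolding elts_omega by blast
    qed
  qed
qed

lemma definable_omega: "definable (\<lambda>N e. e z \<in> elts omega)"
proof (rule definable_cong)
  show "definable (\<lambda>N e. zero_or_succ (e z) \<and> (\<forall>w\<in>N. w \<in> elts (e z) \<longrightarrow> zero_or_succ w))"
    by (rule definable_conj[OF definable_zero_or_succ], rule definable_all[where V = "{z}"])
      (auto intro!: definable_imp definable_mem definable_zero_or_succ)
  fix N and e :: "nat \<Rightarrow> hc"
  assume "transitive N" "range e \<subseteq> N"
  then show "(zero_or_succ (e z) \<and> (\<forall>w\<in>N. w \<in> elts (e z) \<longrightarrow> zero_or_succ w)) \<longleftrightarrow>
      e z \<in> elts omega"
    unfolding omega_iff by (meson range_subsetD transitiveD)
qed

section \<open>Closure under pairing, union and finite subsets\<close>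

definition basic_closed :: "hc set \<Rightarrow> bool" where
  "basic_closed N \<longleftrightarrow> transitive N \<and> omega \<in> N \<and> (\<forall>a\<in>N. \<forall>b\<in>N. hcset {a, b} \<in> N) \<and>
    (\<forall>a\<in>N. hcset (\<Union>(elts ` elts a)) \<in> N)"

lemma axioms_in_ZFC: "pairing_ax \<in> ZFC" "union_ax \<in> ZFC" "infinity_ax \<in> ZFC"
  by (simp_all add: ZFC_def)

lemma ZFC_ensures_pairing: "ZFC_ensures (\<lambda>N. \<forall>a\<in>N. \<forall>b\<in>N. hcset {a, b} \<in> N)"
proof (rule ZFC_ensures_mono[OF ZFC_ensures_axiom[OF axioms_in_ZFC(1)]], intro ballI)
  fix N a b
  assume N: "transitive N" "N \<noteq> {} \<and> (\<forall>e. range e \<subseteq> N \<longrightarrow> sat N e pairing_ax)"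
    and in_N: "a \<in> N" "b \<in> N"
  have "range ((\<lambda>_. a)(1 := b)) \<subseteq> N"
    using in_N by auto
  then have "sat N ((\<lambda>_. a)(1 := b)) pairing_ax"
    using N by blast
  then obtain c where "c \<in> N" "\<forall>w\<in>N. w \<in> elts c \<longleftrightarrow> w \<in> {a, b}"
    by (auto simp: pairing_ax_def)
  then show "hcset {a, b} \<in> N"
    using eq_hcset_iff_in_transitive[OF N(1), of c "{a, b}"] in_N by auto
qed

lemma ZFC_ensures_union: "ZFC_ensures (\<lambda>N. \<forall>a\<in>N. hcset (\<Union>(elts ` elts a)) \<in> N)"
proof (rule ZFC_ensures_mono[OF ZFC_ensures_axiom[OF axioms_in_ZFC(2)]], intro ballI)
  fix N a
  assume N: "transitive N" "N \<noteq> {} \<and> (\<forall>e. range e \<subseteq> N \<longrightarrow> sat N e union_ax)"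
    and a: "a \<in> N"
  have sub: "\<Union>(elts ` elts a) \<subseteq> N"
    using transitiveD[OF N(1)] a by blast
  have "sat N (\<lambda>_. a) union_ax"
    using N a by auto
  then obtain c where "c \<in> N" "\<forall>w\<in>N. w \<in> elts c \<longleftrightarrow> w \<in> \<Union>(elts ` elts a)"
    using transitiveD[OF N(1) a] by (simp add: union_ax_def) (metis (no_types, lifting))
  then show "hcset (\<Union>(elts ` elts a)) \<in> N"
    using eq_hcset_iff_in_transitive[OF N(1), of c "\<Union>(elts ` elts a)"] sub by auto
qed

lemma ZFC_ensures_omega: "ZFC_ensures (\<lambda>N. omega \<in> N)"
proof (rule ZFC_ensures_mono[OF ZFC_ensures_conj[OF
        ZFC_ensures_axiom[OF axioms_in_ZFC(3)] ZFC_ensures_separation[where R = "\<lambda>_ z _ _. z \<in> elts omega",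
            OF definable_omega]]])
  fix N
  assume N: "transitive N"
    and *: "(N \<noteq> {} \<and> (\<forall>e. range e \<subseteq> N \<longrightarrow> sat N e infinity_ax)) \<and>
      (\<forall>A\<in>N. \<forall>p\<in>N. \<forall>q\<in>N. hcset {z \<in> elts A. z \<in> elts omega} \<in> N)"
  then obtain d where "d \<in> N"
    by auto
  then have "sat N (\<lambda>_. d) infinity_ax"
    using * by auto
  then obtain I where I: "I \<in> N"
    and zero: "\<exists>o'\<in>N. o' \<in> elts I \<and> (\<forall>w\<in>N. w \<notin> elts o')"
    and succ: "\<And>x. x \<in> N \<Longrightarrow> x \<in> elts I \<Longrightarrow>
      \<exists>s\<in>N. s \<in> elts I \<and> (\<forall>w\<in>N. w \<in> elts s \<longleftrightarrow> w \<in> elts x \<or> w = x)"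
    by (auto simp: infinity_ax_def)
  have "ord_nat n \<in> elts I" for n
  proof (induction n)
    case 0
    from zero eq_hcset_iff_in_transitive[OF N, of _ "{}"] show ?case
      by auto
  next
    case (Suc n)
    then have "ord_nat n \<in> N"
      using transitiveD[OF N I] by blast
    with succ[OF this Suc] eq_hcset_iff_in_transitive[OF N, of _ "insert (ord_nat n) (elts (ord_nat n))"]
    show ?case
      using transitiveD[OF N] by (auto simp: ord_nat_Suc osucc_def)
  qed
  then have "{z \<in> elts I. z \<in> elts omega} = elts omega"
    by (auto simp: elts_omega)
  then have "hcset {z \<in> elts I. z \<in> elts omega} = omega"
    by simp
  with * I show "omega \<in> N"
    by metis
qed

lemma ZFC_ensures_basic: "ZFC_ensures basic_closed"
  by (rule ZFC_ensures_mono[OF ZFC_ensures_conj[OF ZFC_ensures_pairing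
        ZFC_ensures_conj[OF ZFC_ensures_union ZFC_ensures_omega]]])
    (simp add: basic_closed_def)

lemma
  assumes "basic_closed N"
  shows basic_transitive: "transitive N"
    and basic_omega: "omega \<in> N"
    and basic_upair: "a \<in> N \<Longrightarrow> b \<in> N \<Longrightarrow> hcset {a, b} \<in> N"
    and basic_Union: "a \<in> N \<Longrightarrow> hcset (\<Union>(elts ` elts a)) \<in> N"
  using assms by (auto simp: basic_closed_def)

lemma basic_Un:
  assumes "basic_closed N" "a \<in> N" "b \<in> N"
  shows "hcset (elts a \<union> elts b) \<in> N"
  using basic_Union[OF assms(1) basic_upair[OF assms]] by simp

lemma basic_pair:
  assumes "basic_closed N" "a \<in> N" "b \<in> N"
  shows "pair a b \<in> N"
  using basic_upair[OF assms(1)] assms unfolding pair_def by (metis insert_absorb2)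

lemma basic_ord_nat: "basic_closed N \<Longrightarrow> ord_nat n \<in> N"
  using transitiveD[OF basic_transitive basic_omega] by (auto simp: elts_omega)

lemma basic_zero: "basic_closed N \<Longrightarrow> zero \<in> N"
  using basic_ord_nat[of N 0] by simp

text \<open>
  Finiteness is meant externally; witnesses for finite recursions are obtained in this way.
\<close>

lemma basic_finite:
  assumes "basic_closed N" "finite F" "F \<subseteq> N"
  shows "hcset F \<in> N"
  using assms(2,3)
proof (induction F)
  case empty
  then show ?case
    using basic_zero[OF assms(1)] by simp
next
  case (insert a F)
  then have "hcset (elts (hcset F) \<union> elts (hcset {a, a})) \<in> N"
    by (intro basic_Un basic_upair assms(1)) auto
  then show ?case
    using insert by (simp add: countable_finite)
qed

lemma basic_osucc:
  assumes "basic_closed N" "a \<in> N"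
  shows "osucc a \<in> N"
  using basic_Un[OF assms(1) assms(2) basic_upair[OF assms assms(2)]]
  by (simp add: osucc_def)

section \<open>Ordinal arithmetic below the square of omega\<close>

abbreviation block :: "hc \<Rightarrow> hc \<Rightarrow> hc" where
  "block i m \<equiv> oadd (omult omega i) m"

lemma oadd_zero [simp]: "oadd a zero = a"
  by (rule hc_eqI) (simp add: elts_oadd)

lemma oadd_osucc: "oadd a (osucc b) = osucc (oadd a b)"
  by (rule hc_eqI) (auto simp: elts_oadd)

lemma elts_oadd_omega: "elts (oadd a omega) = elts a \<union> range (\<lambda>n. oadd a (ord_nat n))"
  by (auto simp: elts_oadd elts_omega)

lemma omult_zero [simp]: "omult a zero = zero"
  by (rule hc_eqI) (simp add: elts_omult)

lemma omult_omega_ord_nat: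
  "elts (omult omega (ord_nat i)) = (\<Union>k<i. range (\<lambda>j. block (ord_nat k) (ord_nat j)))"
  by (auto simp: elts_omult elts_ord_nat elts_omega)

lemma omult_omega_Suc: "omult omega (ord_nat (Suc i)) = oadd (omult omega (ord_nat i)) omega"
  by (rule hc_eqI) (simp add: elts_oadd_omega omult_omega_ord_nat lessThan_Suc Un_commute)

lemma elts_omega_squared:
  "elts (omult omega omega) = {block i m |i m. i \<in> elts omega \<and> m \<in> elts omega}"
  by (auto simp: elts_omult)

lemma oadd_notin: "oadd a b \<notin> elts a"
proof
  assume "oadd a b \<in> elts a"
  then have "oadd a b \<in> elts (oadd a b)"
    by (simp add: elts_oadd)
  then show False
    by simp
qed

text \<open>
  A description of \<open>a + \<omega>\<close> by bounded quantifiers, not involving addition: outside \<open>a\<close>, the set is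
  closed under successors, and its elements are \<open>a\<close> itself or successors of elements outside \<open>a\<close>.
  Foundation excludes elements other than \<open>a + n\<close>. This makes the limit step of the recursion for
  \<open>\<omega> \<cdot> n + m\<close> definable.
\<close>

lemma oadd_omega_iff:
  "b = oadd a omega \<longleftrightarrow>
    a \<in> elts b \<and> elts a \<subseteq> elts b \<and> (\<forall>z\<in>elts b. z \<in> elts a \<or> osucc z \<in> elts b) \<and>
    (\<forall>z\<in>elts b. z \<in> elts a \<or> z = a \<or> (\<exists>w\<in>elts b. w \<notin> elts a \<and> z = osucc w))"
  (is "_ \<longleftrightarrow> ?char")
proof
  assume b: "b = oadd a omega"
  have succ: "osucc (oadd a (ord_nat n)) = oadd a (ord_nat (Suc n))" for n
    by (simp add: ord_nat_Suc oadd_osucc)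
  have "z = a \<or> (\<exists>w\<in>elts b. w \<notin> elts a \<and> z = osucc w)" if z: "z = oadd a (ord_nat n)" for z n
  proof (cases n)
    case (Suc k)
    have "oadd a (ord_nat k) \<in> elts b"
      by (auto simp: b elts_oadd_omega)
    with z Suc show ?thesis
      using oadd_notin succ by metis
  qed (simp add: z)
  moreover have "a \<in> elts b"
    unfolding b elts_oadd_omega by (rule UnI2, rule image_eqI[of _ _ 0]) simp_all
  ultimately show ?char
    using succ unfolding b elts_oadd_omega by fastforce
next
  assume c: ?char
  show "b = oadd a omega"
  proof (rule hc_eqI)
    fix z
    have "z \<in> elts b \<Longrightarrow> z \<in> elts (oadd a omega)"
    proof (induction z rule: hc_induct)
      case (1 z)
      then consider "z \<in> elts a" | "z = a" | w where "w \<in> elts b" "w \<notin> elts a" "z = osucc w"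
        using c by blast
      then show ?case
      proof cases
        case 2
        have "a = oadd a (ord_nat 0)"
          by simp
        then show ?thesis
          unfolding 2 elts_oadd_omega by blast
      next
        case 3
        then have "w \<in> elts (oadd a omega)"
          using 1 by simp
        then obtain n where "w = oadd a (ord_nat n)"
          using 3 by (auto simp: elts_oadd_omega)
        then have "z = oadd a (ord_nat (Suc n))"
          using 3 by (simp add: ord_nat_Suc oadd_osucc)
        then show ?thesis
          by (auto simp: elts_oadd_omega)
      qed (simp add: elts_oadd_omega)
    qed
    moreover have "oadd a (ord_nat n) \<in> elts b" for n
    proof (induction n)
      case (Suc n)
      then show ?case
        using c oadd_notin[of a "ord_nat n"] by (auto simp: ord_nat_Suc oadd_osucc)
    qed (use c in simp)
    then have "z \<in> elts (oadd a omega) \<Longrightarrow> z \<in> elts b"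
      using c by (auto simp: elts_oadd_omega)
    ultimately show "z \<in> elts b \<longleftrightarrow> z \<in> elts (oadd a omega)"
      by blast
  qed
qed

lemma definable_oadd_omega: "definable (\<lambda>N e. e b = oadd (e a) omega)"
proof (rule definable_cong)
  show "definable (\<lambda>N e. e a \<in> elts (e b) \<and>
    (\<forall>z\<in>N. z \<in> elts (e a) \<longrightarrow> z \<in> elts (e b)) \<and>
    (\<forall>z\<in>N. z \<in> elts (e b) \<longrightarrow> z \<in> elts (e a) \<or> (\<exists>s\<in>N. s = osucc z \<and> s \<in> elts (e b))) \<and>
    (\<forall>z\<in>N. z \<in> elts (e b) \<longrightarrow> z \<in> elts (e a) \<or> z = e a \<or>
      (\<exists>w\<in>N. w \<in> elts (e b) \<and> w \<notin> elts (e a) \<and> z = osucc w)))"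
    apply (intro definable_conj definable_mem)
      apply (rule definable_all[where V = "{a, b}"])
        apply (auto intro!: definable_imp definable_mem)[3]
     apply (rule definable_all[where V = "{a, b}"], simp)
      subgoal for z
        apply (intro definable_imp definable_disj definable_mem)
        apply (rule definable_ex[where V = "{a, b, z}"])
          apply (auto intro!: definable_conj definable_mem definable_osucc)[3]
        done
     apply auto[1]
    apply (rule definable_all[where V = "{a, b}"], simp)
     subgoal for z
       apply (intro definable_imp definable_disj definable_mem definable_eq)
       apply (rule definable_ex[where V = "{a, b, z}"])
         apply (auto intro!: definable_conj definable_not definable_mem definable_osucc)[3]
       done
    apply auto
    done
  fix N and e :: "nat \<Rightarrow> hc"
  assume N: "transitive N" "range e \<subseteq> N"
  then have "\<And>z. z \<in> elts (e a) \<Longrightarrow> z \<in> N" "\<And>z. z \<in> elts (e b) \<Longrightarrow> z \<in> N"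
    using transitiveD[OF N(1)] by auto
  then show "(e a \<in> elts (e b) \<and>
    (\<forall>z\<in>N. z \<in> elts (e a) \<longrightarrow> z \<in> elts (e b)) \<and>
    (\<forall>z\<in>N. z \<in> elts (e b) \<longrightarrow> z \<in> elts (e a) \<or> (\<exists>s\<in>N. s = osucc z \<and> s \<in> elts (e b))) \<and>
    (\<forall>z\<in>N. z \<in> elts (e b) \<longrightarrow> z \<in> elts (e a) \<or> z = e a \<or>
      (\<exists>w\<in>N. w \<in> elts (e b) \<and> w \<notin> elts (e a) \<and> z = osucc w))) \<longleftrightarrow> e b = oadd (e a) omega"
    unfolding oadd_omega_iff by blast
qed

section \<open>The recursion for ordinal multiplication inside a model\<close>

definition triple :: "hc \<Rightarrow> hc \<Rightarrow> hc \<Rightarrow> hc" where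
  "triple n m y = pair (pair n m) y"

lemma triple_inject [simp]: "triple n m y = triple n' m' y' \<longleftrightarrow> n = n' \<and> m = m' \<and> y = y'"
  by (auto simp: triple_def)

lemma triple_in_transitive:
  "transitive N \<Longrightarrow> triple n m y \<in> N \<Longrightarrow> n \<in> N \<and> m \<in> N \<and> y \<in> N"
  unfolding triple_def by (meson pair_in_transitive)

lemma basic_triple:
  "basic_closed N \<Longrightarrow> n \<in> N \<Longrightarrow> m \<in> N \<Longrightarrow> y \<in> N \<Longrightarrow> triple n m y \<in> N"
  by (simp add: triple_def basic_pair)

lemma definable_triple: "definable (\<lambda>N e. e t = triple (e n) (e m) (e y))"
proof (rule definable_cong)
  show "definable (\<lambda>N e. \<exists>p\<in>N. p = pair (e n) (e m) \<and> e t = pair p (e y))"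
    by (rule definable_ex[where V = "{n, m, y, t}"])
      (auto intro!: definable_conj definable_pair)
  fix N and e :: "nat \<Rightarrow> hc"
  assume "transitive N" "range e \<subseteq> N"
  then show "(\<exists>p\<in>N. p = pair (e n) (e m) \<and> e t = pair p (e y)) \<longleftrightarrow>
      e t = triple (e n) (e m) (e y)"
    unfolding triple_def by (metis pair_in_transitive(1) range_subsetD)
qed

text \<open>
  The graph of \<open>(n, m) \<mapsto> \<omega> \<cdot> n + m\<close> is generated from \<open>(0, 0) \<mapsto> 0\<close> by two kinds of steps: to the
  next element of a block, and from the start of a block to the start of the next one.
\<close>

definition block_step :: "hc \<Rightarrow> hc \<Rightarrow> bool" where
  "block_step s t \<longleftrightarrow> (\<exists>n m y. s = triple n m y \<and>
    (t = triple n (osucc m) (osucc y) \<or> m = zero \<and> t = triple (osucc n) m (oadd y omega)))"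

lemma definable_block_step: "definable (\<lambda>N e. block_step (e s) (e t))"
proof (rule definable_cong)
  show "definable (\<lambda>N e. \<exists>n\<in>N. \<exists>m\<in>N. \<exists>y\<in>N. e s = triple n m y \<and>
    (\<exists>k\<in>N. \<exists>z\<in>N. k = osucc m \<and> z = osucc y \<and> e t = triple n k z \<or>
      m = zero \<and> k = osucc n \<and> z = oadd y omega \<and> e t = triple k m z))"
    apply (rule definable_ex[where V = "{s, t}"], simp)
     subgoal for n
       apply (rule definable_ex[where V = "{s, t, n}"], simp)
        subgoal for m
          apply (rule definable_ex[where V = "{s, t, n, m}"], simp)
           subgoal for y
             apply (rule definable_conj[OF definable_triple])
             apply (rule definable_ex[where V = "{s, t, n, m, y}"], simp)
              subgoal for k
                apply (rule definable_ex[where V = "{s, t, n, m, y, k}"], simp)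
                 apply (intro definable_disj definable_conj definable_osucc definable_oadd_omega
                   definable_triple definable_empty)
                apply auto
                done
             apply auto
             done
          apply auto
          done
       apply auto
       done
    apply auto
    done
  fix N and e :: "nat \<Rightarrow> hc"
  assume N: "transitive N" "range e \<subseteq> N"
  then have s: "\<And>n m y. e s = triple n m y \<Longrightarrow> n \<in> N \<and> m \<in> N \<and> y \<in> N"
    and t: "\<And>n m y. e t = triple n m y \<Longrightarrow> n \<in> N \<and> m \<in> N \<and> y \<in> N"
    by (metis triple_in_transitive range_subsetD)+
  show "(\<exists>n\<in>N. \<exists>m\<in>N. \<exists>y\<in>N. e s = triple n m y \<and>
    (\<exists>k\<in>N. \<exists>z\<in>N. k = osucc m \<and> z = osucc y \<and> e t = triple n k z \<or>
      m = zero \<and> k = osucc n \<and> z = oadd y omega \<and> e t = triple k m z)) \<longleftrightarrow>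
    block_step (e s) (e t)" (is "?L \<longleftrightarrow> _")
  proof
    assume ?L
    then show "block_step (e s) (e t)"
      unfolding block_step_def by blast
  next
    assume "block_step (e s) (e t)"
    then obtain n m y where nmy: "e s = triple n m y" and
      "e t = triple n (osucc m) (osucc y) \<or> m = zero \<and> e t = triple (osucc n) m (oadd y omega)"
      unfolding block_step_def by blast
    then have "\<exists>k\<in>N. \<exists>z\<in>N. k = osucc m \<and> z = osucc y \<and> e t = triple n k z \<or>
      m = zero \<and> k = osucc n \<and> z = oadd y omega \<and> e t = triple k m z"
      using t by blast
    then show ?L
      using s[OF nmy] nmy by blast
  qed
qed

text \<open>
  A witness is a set of triples each of which is the starting triple or has a predecessor in the
  set. For \<open>\<omega> \<cdot> n + m\<close> it suffices to list the starts of the blocks up to the \<open>n\<close>-th and the initial part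
  of that block up to \<open>m\<close>, so that there is a finite witness.
\<close>

definition block_witness :: "hc \<Rightarrow> bool" where
  "block_witness f \<longleftrightarrow>
    (\<forall>t\<in>elts f. t = triple zero zero zero \<or> (\<exists>s\<in>elts f. block_step s t))"

lemma definable_block_witness: "definable (\<lambda>N e. block_witness (e f))"
proof (rule definable_cong)
  show "definable (\<lambda>N e. \<forall>t\<in>N. t \<in> elts (e f) \<longrightarrow>
    (\<exists>z\<in>N. z = zero \<and> t = triple z z z) \<or> (\<exists>s\<in>N. s \<in> elts (e f) \<and> block_step s t))"
    apply (rule definable_all[where V = "{f}"], simp)
     subgoal for t
       apply (intro definable_imp definable_disj definable_mem)
        apply (rule definable_ex[where V = "{f, t}"])
          apply (auto intro!: definable_conj definable_empty definable_triple)[3]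
       apply (rule definable_ex[where V = "{f, t}"])
         apply (auto intro!: definable_conj definable_mem definable_block_step)[3]
       done
    apply auto
    done
  fix N and e :: "nat \<Rightarrow> hc"
  assume N: "transitive N" "range e \<subseteq> N"
  then have "\<And>t. t \<in> elts (e f) \<Longrightarrow> t \<in> N"
    using transitiveD by blast
  then show "(\<forall>t\<in>N. t \<in> elts (e f) \<longrightarrow>
      (\<exists>z\<in>N. z = zero \<and> t = triple z z z) \<or> (\<exists>s\<in>N. s \<in> elts (e f) \<and> block_step s t)) \<longleftrightarrow>
      block_witness (e f)"
    unfolding block_witness_def by (metis N(1) triple_in_transitive)
qed

text \<open>
  Every step increases the last component with respect to membership, so a witness cannot contain
  infinite descending chains of predecessors; the induction is on that component.
\<close>

lemma block_witness_sound:
  assumes "block_witness f" "triple n m y \<in> elts f"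
  shows "\<exists>i j. n = ord_nat i \<and> m = ord_nat j \<and> y = block n m"
  using assms(2)
proof (induction y arbitrary: n m rule: hc_induct)
  case (1 y)
  from assms(1) 1(2) consider "n = zero" "m = zero" "y = zero"
    | s where "s \<in> elts f" "block_step s (triple n m y)"
    unfolding block_witness_def by fastforce
  then show ?case
  proof cases
    case 1
    then show ?thesis
      by (metis oadd_zero omult_zero ord_nat.simps(1))
  next
    case 2
    then obtain n' m' y' where s: "triple n' m' y' \<in> elts f"
      and or: "n = n' \<and> m = osucc m' \<and> y = osucc y' \<or>
        m' = zero \<and> n = osucc n' \<and> m = zero \<and> y = oadd y' omega"
      by (auto simp: block_step_def)
    have "y' \<in> elts (oadd y' omega)"
      using oadd_omega_iff by blast
    with or have "y' \<in> elts y"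
      by auto
    then obtain i j where "n' = ord_nat i" "m' = ord_nat j" "y' = block n' m'"
      using 1(1) s by blast
    moreover have "omult omega (osucc (ord_nat i)) = oadd (omult omega (ord_nat i)) omega"
      by (metis ord_nat_Suc omult_omega_Suc)
    ultimately show ?thesis
      using or by (metis oadd_osucc oadd_zero ord_nat.simps(1) ord_nat_Suc)
  qed
qed

definition is_block :: "hc set \<Rightarrow> hc \<Rightarrow> hc \<Rightarrow> hc \<Rightarrow> bool" where
  "is_block N n m y \<longleftrightarrow> (\<exists>f\<in>N. block_witness f \<and> (\<exists>t\<in>N. t \<in> elts f \<and> t = triple n m y))"

lemma definable_is_block: "definable (\<lambda>N e. is_block N (e n) (e m) (e y))"
  unfolding is_block_def
  apply (rule definable_ex[where V = "{n, m, y}"], simp)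
   subgoal for f
     apply (rule definable_conj[OF definable_block_witness])
     apply (rule definable_ex[where V = "{n, m, y, f}"])
       apply (auto intro!: definable_conj definable_mem definable_triple)
     done
  apply auto
  done

lemma basic_block:
  assumes "basic_closed N" "omult omega (ord_nat i) \<in> N"
  shows "block (ord_nat i) (ord_nat j) \<in> N"
  by (induction j) (simp_all add: assms ord_nat_Suc oadd_osucc basic_osucc)

lemma is_block_ord_nat:
  assumes N: "basic_closed N" and blocks: "\<And>k. k \<le> i \<Longrightarrow> omult omega (ord_nat k) \<in> N"
  shows "is_block N (ord_nat i) (ord_nat j) (block (ord_nat i) (ord_nat j))"
proof -
  \<comment> \<open>The starts of the blocks up to the \<open>i\<close>-th, and the beginning of the \<open>i\<close>-th block.\<close>
  define F where "F = (\<lambda>k. triple (ord_nat k) zero (omult omega (ord_nat k))) ` {..i} \<union>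
    (\<lambda>k. triple (ord_nat i) (ord_nat k) (block (ord_nat i) (ord_nat k))) ` {..j}"
  have F: "finite F"
    by (simp add: F_def)
  then have elts: "elts (hcset F) = F"
    by (simp add: countable_finite)
  have in_N: "F \<subseteq> N"
    unfolding F_def using blocks
    by (auto intro!: basic_triple basic_block basic_ord_nat basic_zero N)
  have starts: "triple (ord_nat k) zero (omult omega (ord_nat k)) \<in> F" if "k \<le> i" for k
    using that by (auto simp: F_def)
  have row: "triple (ord_nat i) (ord_nat k) (block (ord_nat i) (ord_nat k)) \<in> F" if "k \<le> j" for k
    using that by (auto simp: F_def)
  have start_ok: "triple (ord_nat k) zero (omult omega (ord_nat k)) = triple zero zero zero \<or>
      (\<exists>s\<in>F. block_step s (triple (ord_nat k) zero (omult omega (ord_nat k))))" if "k \<le> i" for k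
  proof (cases k)
    case (Suc l)
    then have "triple (ord_nat l) zero (omult omega (ord_nat l)) \<in> F"
      using starts that by simp
    moreover have "block_step (triple (ord_nat l) zero (omult omega (ord_nat l)))
        (triple (ord_nat k) zero (omult omega (ord_nat k)))"
      unfolding Suc omult_omega_Suc block_step_def by (auto simp: ord_nat_Suc)
    ultimately show ?thesis
      by blast
  qed simp
  have row_ok: "triple (ord_nat i) (ord_nat k) (block (ord_nat i) (ord_nat k)) =
        triple zero zero zero \<or>
      (\<exists>s\<in>F. block_step s (triple (ord_nat i) (ord_nat k) (block (ord_nat i) (ord_nat k))))"
    if "k \<le> j" for k
  proof (cases k)
    case (Suc l)
    then have "triple (ord_nat i) (ord_nat l) (block (ord_nat i) (ord_nat l)) \<in> F"
      using row that by simp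
    moreover have "block_step (triple (ord_nat i) (ord_nat l) (block (ord_nat i) (ord_nat l)))
        (triple (ord_nat i) (ord_nat k) (block (ord_nat i) (ord_nat k)))"
      unfolding Suc block_step_def by (auto simp: ord_nat_Suc oadd_osucc)
    ultimately show ?thesis
      by blast
  qed (use start_ok[of i] in simp)
  have "block_witness (hcset F)"
    unfolding block_witness_def elts
  proof
    fix t
    assume "t \<in> F"
    then consider k where "k \<le> i" "t = triple (ord_nat k) zero (omult omega (ord_nat k))"
      | k where "k \<le> j" "t = triple (ord_nat i) (ord_nat k) (block (ord_nat i) (ord_nat k))"
      unfolding F_def by blast
    then show "t = triple zero zero zero \<or> (\<exists>s\<in>F. block_step s t)"
      using start_ok row_ok by cases blast+
  qed
  then show ?thesis
    unfolding is_block_def using basic_finite[OF N F in_N] row[of j] in_N elts by blast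
qed

lemma is_blockD: "is_block N n m y \<Longrightarrow> n \<in> elts omega \<and> m \<in> elts omega \<and> y = block n m"
  unfolding is_block_def elts_omega using block_witness_sound by blast

text \<open>
  If the starts of the first blocks lie in \<open>N\<close>, then so do the finite witnesses for the elements of
  the last of these blocks, replacement collects that block, and its union with what came
  before is the start of the next block.
\<close>

lemma ZFC_ensures_omult_omega:
  "ZFC_ensures (\<lambda>N. basic_closed N \<and> (\<forall>i\<in>elts omega. omult omega i \<in> N))"
proof (rule ZFC_ensures_mono[OF ZFC_ensures_conj[OF ZFC_ensures_basic
        ZFC_ensures_replacement[where R = "\<lambda>N z v p. is_block N p z v", OF definable_is_block]]])
  fix N
  assume asm: "basic_closed N \<and> (\<forall>A\<in>N. \<forall>p\<in>N. \<forall>h.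
    (\<forall>z\<in>elts A. h z \<in> N \<and> (\<forall>v\<in>N. is_block N p z v \<longleftrightarrow> v = h z)) \<longrightarrow> hcset (h ` elts A) \<in> N)"
  then have N: "basic_closed N" ..
  have "omult omega (ord_nat i) \<in> N" for i
  proof (induction i rule: less_induct)
    case (less i)
    show ?case
    proof (cases i)
      case (Suc k)
      then have prev: "\<And>l. l \<le> k \<Longrightarrow> omult omega (ord_nat l) \<in> N"
        using less by simp
      have "block (ord_nat k) z \<in> N \<and> (\<forall>v\<in>N. is_block N (ord_nat k) z v \<longleftrightarrow> v = block (ord_nat k) z)"
        if "z \<in> elts omega" for z
        using that is_block_ord_nat[OF N prev] basic_block[OF N prev[of k]] is_blockD
        by (auto simp: elts_omega)
      then have "hcset (block (ord_nat k) ` elts omega) \<in> N"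
        using asm basic_omega[OF N] basic_ord_nat[OF N] by blast
      from basic_Un[OF N prev[of k] this] show ?thesis
        by (simp add: Suc omult_omega_Suc flip: elts_oadd)
    qed (simp add: basic_zero[OF N])
  qed
  with N show "basic_closed N \<and> (\<forall>i\<in>elts omega. omult omega i \<in> N)"
    by (auto simp: elts_omega)
qed

lemma is_block_iff:
  assumes "basic_closed N" "\<forall>i\<in>elts omega. omult omega i \<in> N"
  shows "is_block N n m y \<longleftrightarrow> n \<in> elts omega \<and> m \<in> elts omega \<and> y = block n m"
  using is_blockD is_block_ord_nat[OF assms(1)] assms(2) by (auto simp: elts_omega)

lemma ZFC_ensures_omega_squared:
  "ZFC_ensures (\<lambda>N. basic_closed N \<and> (\<forall>i\<in>elts omega. omult omega i \<in> N) \<and> omult omega omega \<in> N)"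
proof (rule ZFC_ensures_mono[OF ZFC_ensures_conj[OF ZFC_ensures_omult_omega
        ZFC_ensures_replacement[where R = "\<lambda>N z v p. is_block N z p v", OF definable_is_block]]])
  fix N
  assume asm: "(basic_closed N \<and> (\<forall>i\<in>elts omega. omult omega i \<in> N)) \<and> (\<forall>A\<in>N. \<forall>p\<in>N. \<forall>h.
    (\<forall>z\<in>elts A. h z \<in> N \<and> (\<forall>v\<in>N. is_block N z p v \<longleftrightarrow> v = h z)) \<longrightarrow> hcset (h ` elts A) \<in> N)"
  then have N: "basic_closed N" and blocks: "\<forall>i\<in>elts omega. omult omega i \<in> N"
    by auto
  have "zero \<in> elts omega"
    unfolding omega_iff by (simp add: zero_or_succ_def)
  then have "hcset (omult omega ` elts omega) \<in> N"
    using asm is_block_iff[OF N blocks] basic_zero[OF N] basic_omega[OF N] by auto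
  then have "hcset (\<Union>(elts ` omult omega ` elts omega)) \<in> N"
    using basic_Union[OF N] by fastforce
  moreover have "\<Union>(elts ` omult omega ` elts omega) = elts (omult omega omega)"
  proof -
    have "(\<Union>i. elts (omult omega (ord_nat i))) = (\<Union>k. range (\<lambda>j. block (ord_nat k) (ord_nat j)))"
      unfolding omult_omega_ord_nat by auto
    then show ?thesis
      by (auto simp: elts_omega elts_omult)
  qed
  ultimately show "basic_closed N \<and> (\<forall>i\<in>elts omega. omult omega i \<in> N) \<and> omult omega omega \<in> N"
    using N blocks by simp
qed

section \<open>Closure under the coding map and its inverse\<close>

lemma block_less:
  "i < k \<Longrightarrow> block (ord_nat i) (ord_nat j) \<in> elts (block (ord_nat k) (ord_nat l))"
  by (auto simp: elts_oadd omult_omega_ord_nat)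

lemma block_less_same:
  "j < l \<Longrightarrow> block (ord_nat i) (ord_nat j) \<in> elts (block (ord_nat i) (ord_nat l))"
  by (auto simp: elts_oadd elts_ord_nat)

lemma block_inject:
  assumes "i \<in> elts omega" "m \<in> elts omega" "i' \<in> elts omega" "m' \<in> elts omega"
  shows "block i m = block i' m' \<longleftrightarrow> i = i' \<and> m = m'"
proof
  assume *: "block i m = block i' m'"
  obtain a b a' b' where nat: "i = ord_nat a" "m = ord_nat b" "i' = ord_nat a'" "m' = ord_nat b'"
    using assms by (auto simp: elts_omega)
  have "a = a'"
    using * block_less mem_irrefl unfolding nat by (metis linorder_neqE_nat)
  moreover from this have "b = b'"
    using * block_less_same mem_irrefl unfolding nat by (metis linorder_neqE_nat)
  ultimately show "i = i' \<and> m = m'"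
    by (simp add: nat)
qed simp

text \<open>
  Since \<open>y = \<omega> \<cdot> n + m\<close> determines \<open>n\<close> and \<open>m\<close>, the table is the image of \<open>\<omega> \<cdot> \<omega>\<close> under a definable
  function, and one application of replacement produces it.
\<close>

lemma ZFC_ensures_block_table:
  assumes def: "\<And>v n m y. definable (\<lambda>N e. e v = E (e n) (e m) (e y))"
    and closed: "\<And>N n m y. basic_closed N \<Longrightarrow> n \<in> N \<Longrightarrow> m \<in> N \<Longrightarrow> y \<in> N \<Longrightarrow> E n m y \<in> N"
  shows "ZFC_ensures (\<lambda>N. hcset ((\<lambda>(i, m). E i m (block i m)) ` (elts omega \<times> elts omega)) \<in> N)"
proof -
  have "definable (\<lambda>N e. \<exists>n\<in>N. \<exists>m\<in>N. is_block N n m (e z) \<and> e v = E n m (e z))" for z v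
    apply (rule definable_ex[where V = "{z, v}"], simp)
     subgoal for n
       by (rule definable_ex[where V = "{z, v, n}"])
         (auto intro!: definable_conj definable_is_block def)
    apply auto
    done
  then show ?thesis
  proof (rule ZFC_ensures_mono[OF ZFC_ensures_conj[OF ZFC_ensures_omega_squared
          ZFC_ensures_replacement[where
            R = "\<lambda>N z v p. \<exists>n\<in>N. \<exists>m\<in>N. is_block N n m z \<and> v = E n m z"]]])
    fix N
    assume asm: "(basic_closed N \<and> (\<forall>i\<in>elts omega. omult omega i \<in> N) \<and> omult omega omega \<in> N) \<and>
      (\<forall>A\<in>N. \<forall>p\<in>N. \<forall>h. (\<forall>z\<in>elts A. h z \<in> N \<and>
        (\<forall>v\<in>N. (\<exists>n\<in>N. \<exists>m\<in>N. is_block N n m z \<and> v = E n m z) \<longleftrightarrow> v = h z)) \<longrightarrow>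
        hcset (h ` elts A) \<in> N)"
    then have N: "basic_closed N" and blocks: "\<forall>i\<in>elts omega. omult omega i \<in> N"
      and squared: "omult omega omega \<in> N"
      by auto
    have in_N: "i \<in> N" if "i \<in> elts omega" for i
      using that transitiveD[OF basic_transitive basic_omega] N by blast
    \<comment> \<open>The coordinates of \<open>z\<close> are unique, which makes the description well-defined on \<open>\<omega> \<cdot> \<omega>\<close>.\<close>
    define h where "h = (\<lambda>z. THE v. \<exists>i\<in>elts omega. \<exists>m\<in>elts omega. z = block i m \<and> v = E i m z)"
    have h: "h (block i m) = E i m (block i m)" if "i \<in> elts omega" "m \<in> elts omega" for i m
      unfolding h_def using that block_inject by (intro the_equality) blast+
    have "h z \<in> N \<and> (\<forall>v\<in>N. (\<exists>n\<in>N. \<exists>m\<in>N. is_block N n m z \<and> v = E n m z) \<longleftrightarrow> v = h z)"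
      if z: "z \<in> elts (omult omega omega)" for z
    proof -
      from z obtain i m where im: "i \<in> elts omega" "m \<in> elts omega" and z_eq: "z = block i m"
        unfolding elts_omega_squared by blast
      have "z \<in> N"
        using transitiveD[OF basic_transitive[OF N] squared z] .
      then have "h z \<in> N"
        unfolding z_eq h[OF im] using closed[OF N] in_N im by blast
      moreover have "is_block N n k z \<longleftrightarrow> n = i \<and> k = m" for n k
        using is_block_iff[OF N blocks] im block_inject z_eq by blast
      ultimately show ?thesis
        using h[OF im] in_N im z_eq by auto
    qed
    then have "hcset (h ` elts (omult omega omega)) \<in> N"
      using asm by blast
    moreover have "h ` elts (omult omega omega) =
        (\<lambda>(i, m). E i m (block i m)) ` (elts omega \<times> elts omega)"
      unfolding elts_omega_squared using h by force
    ultimately show "hcset ((\<lambda>(i, m). E i m (block i m)) ` (elts omega \<times> elts omega)) \<in> N"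
      by simp
  qed
qed

text \<open>
  A sequence is a set of pairs, and the coding map replaces \<open>(i, m)\<close> by \<open>(i, \<omega> \<cdot> i + m)\<close>. This
  function on pairs and its inverse are sets; with them as parameters, coding and decoding of
  sequences, trees and sets of trees are image formations.
\<close>

definition hat_table :: hc where
  "hat_table = hcset ((\<lambda>(i, m). pair (pair i m) (pair i (block i m))) ` (elts omega \<times> elts omega))"

definition unhat_table :: hc where
  "unhat_table = hcset ((\<lambda>(i, m). pair (pair i (block i m)) (pair i m)) ` (elts omega \<times> elts omega))"

lemma definable_pair_pair: "definable (\<lambda>N e. e v = pair (pair (e a) (e b)) (pair (e c) (e d)))"
proof (rule definable_cong)
  show "definable (\<lambda>N e. \<exists>p\<in>N. \<exists>q\<in>N. p = pair (e a) (e b) \<and> q = pair (e c) (e d) \<and> e v = pair p q)"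
    apply (rule definable_ex[where V = "{a, b, c, d, v}"], simp)
     subgoal for p
       by (rule definable_ex[where V = "{a, b, c, d, v, p}"])
         (auto intro!: definable_conj definable_pair)
    apply auto
    done
  fix N and e :: "nat \<Rightarrow> hc"
  assume "transitive N" "range e \<subseteq> N"
  then show "(\<exists>p\<in>N. \<exists>q\<in>N. p = pair (e a) (e b) \<and> q = pair (e c) (e d) \<and> e v = pair p q) \<longleftrightarrow>
      e v = pair (pair (e a) (e b)) (pair (e c) (e d))"
    by (metis pair_in_transitive(1,2) range_subsetD)
qed

lemma ZFC_ensures_tables: "ZFC_ensures (\<lambda>N. hat_table \<in> N \<and> unhat_table \<in> N)"
  unfolding hat_table_def unhat_table_def
  by (intro ZFC_ensures_conj ZFC_ensures_block_table definable_pair_pair basic_pair)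

definition img :: "hc \<Rightarrow> hc \<Rightarrow> hc" where
  "img K f = hcset {b. \<exists>a\<in>elts f. pair a b \<in> elts K}"

lemma img_subset: "{b. \<exists>a\<in>elts f. pair a b \<in> elts K} \<subseteq> \<Union>(elts ` \<Union>(elts ` elts K))"
proof clarify
  fix a b
  assume K: "pair a b \<in> elts K"
  have "hcset {a, b} \<in> elts (pair a b)" "b \<in> elts (hcset {a, b})"
    by (simp_all add: pair_def)
  with K show "b \<in> \<Union>(elts ` \<Union>(elts ` elts K))"
    by blast
qed

lemma elts_img [simp]: "elts (img K f) = {b. \<exists>a\<in>elts f. pair a b \<in> elts K}"
  unfolding img_def by (rule elts_hcset[OF countable_subset[OF img_subset]]) simp

lemma definable_img: "definable (\<lambda>N e. e g = img (e K) (e f))"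
proof (rule definable_cong)
  show "definable (\<lambda>N e. \<forall>b\<in>N. b \<in> elts (e g) \<longleftrightarrow>
      (\<exists>a\<in>N. a \<in> elts (e f) \<and> (\<exists>p\<in>N. p \<in> elts (e K) \<and> p = pair a b)))"
    apply (rule definable_all[where V = "{g, K, f}"], simp)
     subgoal for b
       apply (rule definable_iff[OF definable_mem])
       apply (rule definable_ex[where V = "{g, K, f, b}"], simp)
        subgoal for a
          apply (rule definable_conj[OF definable_mem])
          apply (rule definable_ex[where V = "{g, K, f, a, b}"])
            apply (auto intro!: definable_conj definable_mem definable_pair)
          done
       apply auto
       done
    apply auto
    done
  fix N and e :: "nat \<Rightarrow> hc"
  assume N: "transitive N" "range e \<subseteq> N"
  then have in_N: "e x \<in> N" "z \<in> elts (e x) \<Longrightarrow> z \<in> N" for x z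
    using transitiveD[OF N(1)] by blast+
  have "b \<in> N" if "pair a b \<in> elts (e K)" for a b
    using pair_in_transitive(2)[OF N(1)] in_N(2) that by blast
  then have "{b. \<exists>a\<in>elts (e f). pair a b \<in> elts (e K)} \<subseteq> N"
    by blast
  note iff = eq_hcset_iff_in_transitive[OF N(1) in_N(1)[of g] this
      countable_subset[OF img_subset], folded img_def]
  show "(\<forall>b\<in>N. b \<in> elts (e g) \<longleftrightarrow>
      (\<exists>a\<in>N. a \<in> elts (e f) \<and> (\<exists>p\<in>N. p \<in> elts (e K) \<and> p = pair a b))) \<longleftrightarrow>
      e g = img (e K) (e f)"
    by (subst iff) (use in_N(2) in \<open>simp, blast\<close>)
qed

lemma ZFC_ensures_img: "ZFC_ensures (\<lambda>N. basic_closed N \<and> (\<forall>K\<in>N. \<forall>f\<in>N. img K f \<in> N))"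
proof -
  have "definable (\<lambda>N e. \<exists>a\<in>N. a \<in> elts (e f) \<and> (\<exists>p\<in>N. p \<in> elts (e K) \<and> p = pair a (e b)))" for b K f
    apply (rule definable_ex[where V = "{K, f, b}"], simp)
     subgoal for a
       apply (rule definable_conj[OF definable_mem])
       apply (rule definable_ex[where V = "{K, f, a, b}"])
         apply (auto intro!: definable_conj definable_mem definable_pair)
       done
    apply auto
    done
  then show ?thesis
  proof (rule ZFC_ensures_mono[OF ZFC_ensures_conj[OF ZFC_ensures_basic
          ZFC_ensures_separation[where
            R = "\<lambda>N b K f. \<exists>a\<in>N. a \<in> elts f \<and> (\<exists>p\<in>N. p \<in> elts K \<and> p = pair a b)"]]])
    fix N
    assume asm: "basic_closed N \<and> (\<forall>A\<in>N. \<forall>K\<in>N. \<forall>f\<in>N.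
      hcset {b \<in> elts A. \<exists>a\<in>N. a \<in> elts f \<and> (\<exists>p\<in>N. p \<in> elts K \<and> p = pair a b)} \<in> N)"
    then have N: "basic_closed N" ..
    have in_N: "a \<in> N" if "f \<in> N" "a \<in> elts f" for a f
      using transitiveD[OF basic_transitive[OF N] that] .
    have "img K f \<in> N" if "K \<in> N" "f \<in> N" for K f
    proof -
      \<comment> \<open>Second components of pairs in \<open>K\<close> occur two levels below \<open>K\<close>, so this set bounds the image.\<close>
      define A where "A = hcset (\<Union>(elts ` elts (hcset (\<Union>(elts ` elts K)))))"
      have A_in_N: "A \<in> N"
        unfolding A_def using basic_Union[OF N] that by blast
      have elts_A: "elts A = \<Union>(elts ` \<Union>(elts ` elts K))"
        by (simp add: A_def)
      have "b \<in> elts A \<and> (\<exists>a\<in>N. a \<in> elts f \<and> (\<exists>p\<in>N. p \<in> elts K \<and> p = pair a b)) \<longleftrightarrow>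
          (\<exists>a\<in>elts f. pair a b \<in> elts K)" for b
      proof
        assume "\<exists>a\<in>elts f. pair a b \<in> elts K"
        then obtain a where a: "a \<in> elts f" "pair a b \<in> elts K"
          by blast
        then have "b \<in> elts A"
          using img_subset[of f K] unfolding elts_A by blast
        with a show "b \<in> elts A \<and> (\<exists>a\<in>N. a \<in> elts f \<and> (\<exists>p\<in>N. p \<in> elts K \<and> p = pair a b))"
          using in_N that by blast
      qed blast
      then have "hcset {b \<in> elts A. \<exists>a\<in>N. a \<in> elts f \<and> (\<exists>p\<in>N. p \<in> elts K \<and> p = pair a b)} = img K f"
        unfolding img_def by (simp only:)
      with asm[THEN conjunct2, rule_format, OF A_in_N that] show ?thesis
        by (simp only:)
    qed
    with N show "basic_closed N \<and> (\<forall>K\<in>N. \<forall>f\<in>N. img K f \<in> N)"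
      by blast
  qed
qed

text \<open>
  Images one and two levels further down: for a tree, a set of sequences, and for a set of trees.
\<close>

definition img2 :: "hc \<Rightarrow> hc \<Rightarrow> hc" where
  "img2 K T = hcset (img K ` elts T)"

definition img3 :: "hc \<Rightarrow> hc \<Rightarrow> hc" where
  "img3 K P = hcset (img2 K ` elts P)"

lemma ZFC_ensures_img2:
  "ZFC_ensures (\<lambda>N. basic_closed N \<and> (\<forall>K\<in>N. \<forall>f\<in>N. img K f \<in> N \<and> img2 K f \<in> N))"
proof (rule ZFC_ensures_mono[OF ZFC_ensures_conj[OF ZFC_ensures_img
        ZFC_ensures_replacement[where R = "\<lambda>_ f g K. g = img K f", OF definable_img]]])
  fix N
  assume asm: "(basic_closed N \<and> (\<forall>K\<in>N. \<forall>f\<in>N. img K f \<in> N)) \<and> (\<forall>A\<in>N. \<forall>K\<in>N. \<forall>h.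
    (\<forall>f\<in>elts A. h f \<in> N \<and> (\<forall>g\<in>N. g = img K f \<longleftrightarrow> g = h f)) \<longrightarrow> hcset (h ` elts A) \<in> N)"
  then have "img2 K T \<in> N" if "K \<in> N" "T \<in> N" for K T
    unfolding img2_def using that transitiveD[OF basic_transitive] by blast
  with asm show "basic_closed N \<and> (\<forall>K\<in>N. \<forall>f\<in>N. img K f \<in> N \<and> img2 K f \<in> N)"
    by blast
qed

lemma ZFC_ensures_img3:
  "ZFC_ensures (\<lambda>N. \<forall>K\<in>N. \<forall>f\<in>N. img K f \<in> N \<and> img2 K f \<in> N \<and> img3 K f \<in> N)"
proof -
  have "definable (\<lambda>N e. \<forall>g\<in>N. g \<in> elts (e U) \<longleftrightarrow> (\<exists>f\<in>N. f \<in> elts (e T) \<and> g = img (e K) f))" for K T U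
    apply (rule definable_all[where V = "{K, T, U}"], simp)
     subgoal for g
       apply (rule definable_iff[OF definable_mem])
       apply (rule definable_ex[where V = "{K, T, U, g}"])
         apply (auto intro!: definable_conj definable_mem definable_img)
       done
    apply auto
    done
  then show ?thesis
  proof (rule ZFC_ensures_mono[OF ZFC_ensures_conj[OF ZFC_ensures_img2
          ZFC_ensures_replacement[where
            R = "\<lambda>N T U K. \<forall>g\<in>N. g \<in> elts U \<longleftrightarrow> (\<exists>f\<in>N. f \<in> elts T \<and> g = img K f)"]]])
    fix N
    assume asm: "(basic_closed N \<and> (\<forall>K\<in>N. \<forall>f\<in>N. img K f \<in> N \<and> img2 K f \<in> N)) \<and>
      (\<forall>A\<in>N. \<forall>K\<in>N. \<forall>h. (\<forall>T\<in>elts A. h T \<in> N \<and>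
        (\<forall>U\<in>N. (\<forall>g\<in>N. g \<in> elts U \<longleftrightarrow> (\<exists>f\<in>N. f \<in> elts T \<and> g = img K f)) \<longleftrightarrow> U = h T)) \<longrightarrow>
        hcset (h ` elts A) \<in> N)"
    from asm[THEN conjunct1, THEN conjunct1] have N: "transitive N"
      by (rule basic_transitive)
    from asm[THEN conjunct1, THEN conjunct2]
    have closed: "\<And>K f. K \<in> N \<Longrightarrow> f \<in> N \<Longrightarrow> img K f \<in> N \<and> img2 K f \<in> N"
      by blast
    have "(\<forall>g\<in>N. g \<in> elts U \<longleftrightarrow> (\<exists>f\<in>N. f \<in> elts T \<and> g = img K f)) \<longleftrightarrow> U = img2 K T"
      if "K \<in> N" "T \<in> N" "U \<in> N" for K T U
    proof -
      have "img K ` elts T \<subseteq> N"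
        using that closed transitiveD[OF N] by blast
      then have "U = img2 K T \<longleftrightarrow> (\<forall>g\<in>N. g \<in> elts U \<longleftrightarrow> g \<in> img K ` elts T)"
        unfolding img2_def using eq_hcset_iff_in_transitive[OF N \<open>U \<in> N\<close>] by simp
      moreover have "g \<in> img K ` elts T \<longleftrightarrow> (\<exists>f\<in>N. f \<in> elts T \<and> g = img K f)" for g
        using transitiveD[OF N \<open>T \<in> N\<close>] by blast
      ultimately show ?thesis
        by simp
    qed
    then have "img3 K P \<in> N" if "K \<in> N" "P \<in> N" for K P
      unfolding img3_def using that closed transitiveD[OF N \<open>P \<in> N\<close>]
      by (intro asm[THEN conjunct2, rule_format, of P K]) simp_all
    with closed show "\<forall>K\<in>N. \<forall>f\<in>N. img K f \<in> N \<and> img2 K f \<in> N \<and> img3 K f \<in> N"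
      by blast
  qed
qed

definition hat_closed :: "hc set \<Rightarrow> bool" where
  "hat_closed N \<longleftrightarrow> (\<forall>K\<in>{hat_table, unhat_table}. \<forall>f\<in>N. img K f \<in> N \<and> img2 K f \<in> N \<and> img3 K f \<in> N)"

lemma ZFC_ensures_hat_closed: "ZFC_ensures hat_closed"
  by (rule ZFC_ensures_mono[OF ZFC_ensures_conj[OF ZFC_ensures_tables ZFC_ensures_img3]])
    (auto simp: hat_closed_def)

section \<open>The coding map on sequences\<close>

lemma lam_cong: "(\<And>i. i \<in> elts a \<Longrightarrow> g i = h i) \<Longrightarrow> lam a g = lam a h"
  unfolding lam_def by (metis (mono_tags, lifting) image_cong)

lemma dom_of_lam [simp]: "dom_of (lam a h) = elts a"
  by (auto simp: dom_of_def)

lemma hat_lam: "hat (lam a h) = lam a (\<lambda>i. block i (h i))"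
  unfolding hat_def by (auto intro!: lam_cong)

lemma restr_lam: "restr (lam a h) b = lam (hcset (elts a \<inter> elts b)) h"
  by (rule hc_eqI) (auto simp: countable_Int1)

text \<open>
  A common frame for finite and infinite sequences, closed under restriction.
\<close>

definition omega_partial :: "hc \<Rightarrow> bool" where
  "omega_partial s \<longleftrightarrow>
    (\<exists>a h. s = lam a h \<and> elts a \<subseteq> elts omega \<and> (\<forall>i\<in>elts a. h i \<in> elts omega))"

lemma elts_hat_table:
  "elts hat_table = {pair (pair i m) (pair i (block i m)) |i m. i \<in> elts omega \<and> m \<in> elts omega}"
  unfolding hat_table_def by auto

lemma elts_unhat_table:
  "elts unhat_table = {pair (pair i (block i m)) (pair i m) |i m. i \<in> elts omega \<and> m \<in> elts omega}"
  unfolding unhat_table_def by auto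

lemma img_hat_table: "omega_partial s \<Longrightarrow> img hat_table s = hat s"
  unfolding omega_partial_def
  by (rule hc_eqI) (auto simp: hat_lam elts_hat_table image_iff subset_iff)

lemma img_unhat_table: "omega_partial s \<Longrightarrow> img unhat_table (hat s) = s"
  unfolding omega_partial_def
  by (rule hc_eqI) (auto simp: hat_lam elts_unhat_table image_iff block_inject subset_iff)

lemma hat_inject: "omega_partial s \<Longrightarrow> omega_partial t \<Longrightarrow> hat s = hat t \<longleftrightarrow> s = t"
  by (metis img_unhat_table)

lemma hat_restr: "omega_partial s \<Longrightarrow> hat (restr s b) = restr (hat s) b"
  by (auto simp: omega_partial_def restr_lam hat_lam)

lemma omega_partial_restr: "omega_partial s \<Longrightarrow> omega_partial (restr s b)"
  unfolding omega_partial_def by (fastforce simp: restr_lam countable_Int1)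

lemma omega_elts_subset: "n \<in> elts omega \<Longrightarrow> elts n \<subseteq> elts omega"
  by (auto simp: elts_omega elts_ord_nat)

lemma funcs_omega_partial:
  "elts a \<subseteq> elts omega \<Longrightarrow> s \<in> funcs a omega \<Longrightarrow> omega_partial s"
  by (auto simp: funcs_def omega_partial_def)

lemma seqs_omega_partial: "s \<in> seqs omega \<Longrightarrow> omega_partial s"
  using funcs_omega_partial omega_elts_subset by (auto simp: seqs_def)

lemma block_in_omega_squared:
  "i \<in> elts omega \<Longrightarrow> m \<in> elts omega \<Longrightarrow> block i m \<in> elts (omult omega omega)"
  by (auto simp: elts_omega_squared)

lemma hat_in_funcs:
  assumes "elts a \<subseteq> elts omega" "s \<in> funcs a omega"
  shows "hat s \<in> funcs a (omult omega omega)"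
proof -
  from assms(2) obtain h where s: "s = lam a h" and "\<forall>i\<in>elts a. h i \<in> elts omega"
    by (auto simp: funcs_def)
  with assms(1) show ?thesis
    unfolding funcs_def s hat_lam using block_in_omega_squared by blast
qed

lemma hat_in_seqs: "s \<in> seqs omega \<Longrightarrow> hat s \<in> seqs (omult omega omega)"
  using hat_in_funcs omega_elts_subset unfolding seqs_def by blast

section \<open>The coding map on trees and branches\<close>

lemma elts_hat_tree [simp]: "elts (hat_tree T) = hat ` elts T"
  by (simp add: hat_tree_def)

lemma elts_hat_forcing [simp]: "elts (hat_forcing P) = hat_tree ` elts P"
  by (simp add: hat_forcing_def)

lemma tree_omega_partial: "tree_on omega T \<Longrightarrow> s \<in> elts T \<Longrightarrow> omega_partial s"
  by (auto simp: tree_on_def intro: seqs_omega_partial)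

lemma img2_hat_table: "tree_on omega T \<Longrightarrow> img2 hat_table T = hat_tree T"
  unfolding img2_def hat_tree_def
  by (intro arg_cong[where f = hcset] image_cong) (auto intro: img_hat_table tree_omega_partial)

lemma img2_unhat_table:
  assumes "tree_on omega T"
  shows "img2 unhat_table (hat_tree T) = T"
proof -
  have "img unhat_table ` hat ` elts T = elts T"
    using img_unhat_table[OF tree_omega_partial[OF assms]] by force
  then show ?thesis
    by (simp add: img2_def)
qed

lemma hat_tree_subset_iff:
  assumes "tree_on omega S" "tree_on omega T"
  shows "elts (hat_tree S) \<subseteq> elts (hat_tree T) \<longleftrightarrow> elts S \<subseteq> elts T"
  using assms hat_inject tree_omega_partial by (auto simp: subset_iff image_iff)

lemma inj_on_hat_tree: "\<forall>T\<in>A. tree_on omega T \<Longrightarrow> inj_on hat_tree A"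
  by (metis img2_unhat_table inj_onI)

lemma tree_on_hat_tree:
  assumes T: "tree_on omega T"
  shows "tree_on (omult omega omega) (hat_tree T)"
  using T hat_in_seqs hat_restr[OF tree_omega_partial[OF T], symmetric]
  by (fastforce simp: tree_on_def)

lemma hat_branch:
  assumes "tree_on omega T" "x \<in> branches omega T"
  shows "hat x \<in> branches (omult omega omega) (hat_tree T)"
proof -
  have x: "x \<in> funcs omega omega" "\<forall>n\<in>elts omega. restr x n \<in> elts T"
    using assms(2) by (auto simp: branches_def)
  moreover have "omega_partial x"
    using x(1) funcs_omega_partial by blast
  ultimately show ?thesis
    using hat_in_funcs hat_restr by (auto simp: branches_def simp flip: hat_restr)
qed

text \<open>
  The \<open>i\<close>-th value of a branch through the coded tree is read off from its restriction to \<open>i + 1\<close>,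
  which is a coded node; hence it lies in the \<open>i\<close>-th block, and the branch can be decoded.
\<close>

lemma branch_hatE:
  assumes T: "tree_on omega T" and c: "c \<in> branches (omult omega omega) (hat_tree T)"
  obtains x where "x \<in> branches omega T" "c = hat x"
proof -
  from c obtain g where g: "c = lam omega g"
    and restr: "\<And>n. n \<in> elts omega \<Longrightarrow> restr c n \<in> hat ` elts T"
    by (auto simp: branches_def funcs_def)
  have restr_c: "restr c n = lam n g" if "n \<in> elts omega" for n
    using omega_elts_subset[OF that] by (simp add: g restr_lam Int_absorb1)
  have "\<exists>m\<in>elts omega. g i = block i m" if i: "i \<in> elts omega" for i
  proof -
    obtain k where k: "i = ord_nat k"
      using i by (auto simp: elts_omega)
    \<comment> \<open>The restriction to \<open>i + 1\<close> is the shortest one that contains the value at \<open>i\<close>.\<close>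
    then have succ: "osucc i \<in> elts omega"
      by (auto simp: elts_omega ord_nat_Suc[symmetric])
    then obtain s where s: "s \<in> elts T" "lam (osucc i) g = hat s"
      using restr restr_c by (metis imageE)
    then obtain a h where a: "s = lam a h" "\<forall>i\<in>elts a. h i \<in> elts omega"
      using tree_omega_partial[OF T s(1)] unfolding omega_partial_def by blast
    with s have eq: "lam (osucc i) g = lam a (\<lambda>i. block i (h i))"
      by (simp add: hat_lam)
    then have "elts a = elts (osucc i)"
      by (metis dom_of_lam)
    then have "i \<in> elts a"
      by simp
    with eq have "g i = block i (h i)"
      by (metis app_lam elts_osucc insertI1)
    with a \<open>i \<in> elts a\<close> show ?thesis
      by blast
  qed
  then obtain h where h: "\<And>i. i \<in> elts omega \<Longrightarrow> h i \<in> elts omega \<and> g i = block i (h i)"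
    by metis
  define x where "x = lam omega h"
  have x: "x \<in> funcs omega omega"
    using h by (auto simp: x_def funcs_def)
  have c_eq: "c = hat x"
    unfolding g x_def hat_lam using h by (intro lam_cong) blast
  have "restr x n \<in> elts T" if n: "n \<in> elts omega" for n
  proof -
    have part: "omega_partial x"
      using x funcs_omega_partial by blast
    obtain s where "s \<in> elts T" "hat (restr x n) = hat s"
      using restr[OF n] unfolding c_eq hat_restr[OF part] by blast
    then show ?thesis
      using hat_inject omega_partial_restr[OF part] tree_omega_partial[OF T] by metis
  qed
  then have "x \<in> branches omega T"
    using x by (simp add: branches_def)
  then show thesis
    using c_eq that by blast
qed

text \<open>
  Nonemptiness of \<open>G\<close> matters: only the trees in it force a branch to be a coded sequence. As coding
  is injective, the sequences decoded from different trees agree.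
\<close>

lemma branch_of_hat_iff:
  assumes G: "G \<noteq> {}" "\<forall>T\<in>G. tree_on omega T"
  shows "branch_of (omult omega omega) (hat_tree ` G) c \<longleftrightarrow> (\<exists>x. branch_of omega G x \<and> c = hat x)"
proof
  assume c: "branch_of (omult omega omega) (hat_tree ` G) c"
  then have ex: "\<exists>x. x \<in> branches omega T \<and> c = hat x" if "T \<in> G" for T
    using branch_hatE G(2) that unfolding branch_of_def by (metis imageI)
  obtain T\<^sub>0 where "T\<^sub>0 \<in> G"
    using G(1) by blast
  with ex obtain x where x: "x \<in> branches omega T\<^sub>0" "c = hat x"
    by blast
  have part: "omega_partial y" if "y \<in> branches omega T" for y T
    using that funcs_omega_partial by (auto simp: branches_def)
  have "x \<in> branches omega T" if "T \<in> G" for T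
    using ex[OF that] x part hat_inject by metis
  then show "\<exists>x. branch_of omega G x \<and> c = hat x"
    using x by (auto simp: branch_of_def branches_def)
next
  assume "\<exists>x. branch_of omega G x \<and> c = hat x"
  then show "branch_of (omult omega omega) (hat_tree ` G) c"
    using G(2) hat_branch hat_in_funcs by (auto simp: branch_of_def)
qed

section \<open>Transfer of generic filters\<close>

text \<open>
  An order isomorphism transports generic filters as soon as the preimages of the dense sets in
  \<open>M\<close> lie in \<open>M\<close>: they are dense again, and the filter meets them.
\<close>

lemma generic_image:
  assumes bij: "bij_betw j (elts P) (elts Q)"
    and order: "\<And>p q. p \<in> elts P \<Longrightarrow> q \<in> elts P \<Longrightarrow> elts (j p) \<subseteq> elts (j q) \<longleftrightarrow> elts p \<subseteq> elts q"
    and vimage: "\<And>D. D \<in> M \<Longrightarrow> elts D \<subseteq> elts Q \<Longrightarrow> hcset {p \<in> elts P. j p \<in> elts D} \<in> M"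
    and G: "generic M P G"
  shows "generic M Q (j ` G)"
proof -
  have Q: "elts Q = j ` elts P"
    using bij by (simp add: bij_betw_def)
  have filter: "G \<subseteq> elts P" "G \<noteq> {}"
      "\<And>p q. p \<in> G \<Longrightarrow> q \<in> elts P \<Longrightarrow> elts p \<subseteq> elts q \<Longrightarrow> q \<in> G"
      "\<And>p q. p \<in> G \<Longrightarrow> q \<in> G \<Longrightarrow> \<exists>r\<in>G. elts r \<subseteq> elts p \<and> elts r \<subseteq> elts q"
    and meets: "\<And>D. D \<in> M \<Longrightarrow> dense_in P (elts D) \<Longrightarrow> G \<inter> elts D \<noteq> {}"
    using G unfolding generic_def filter_on_def by blast+
  have "filter_on Q (j ` G)"
    unfolding filter_on_def Q
  proof (intro conjI ballI impI)
    show "j ` G \<subseteq> j ` elts P" "j ` G \<noteq> {}"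
      using filter by auto
  next
    fix p q
    assume "p \<in> j ` G" "q \<in> j ` elts P" "elts p \<subseteq> elts q"
    then show "q \<in> j ` G"
      using filter(1,3) order by blast
  next
    fix p q
    assume "p \<in> j ` G" "q \<in> j ` G"
    then obtain p' q' where pq: "p' \<in> G" "q' \<in> G" "p = j p'" "q = j q'"
      by blast
    then obtain r where "r \<in> G" "elts r \<subseteq> elts p'" "elts r \<subseteq> elts q'"
      using filter(4) by blast
    moreover from this have "elts (j r) \<subseteq> elts p" "elts (j r) \<subseteq> elts q"
      using order filter(1) pq by blast+
    ultimately show "\<exists>r\<in>j ` G. elts r \<subseteq> elts p \<and> elts r \<subseteq> elts q"
      by blast
  qed
  moreover have "j ` G \<inter> elts D \<noteq> {}" if D: "D \<in> M" "dense_in Q (elts D)" for D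
  proof -
    have sub: "elts D \<subseteq> elts Q" and dense: "\<And>q. q \<in> elts Q \<Longrightarrow> \<exists>d\<in>elts D. elts d \<subseteq> elts q"
      using D(2) by (auto simp: dense_in_def)
    have "\<exists>d\<in>{p \<in> elts P. j p \<in> elts D}. elts d \<subseteq> elts p" if p: "p \<in> elts P" for p
    proof -
      obtain d where d: "d \<in> elts D" "elts d \<subseteq> elts (j p)"
        using dense p Q by blast
      then obtain p' where "p' \<in> elts P" "d = j p'"
        using sub Q by blast
      with d p order show ?thesis
        by blast
    qed
    then have "dense_in P (elts (hcset {p \<in> elts P. j p \<in> elts D}))"
      by (auto simp: dense_in_def)
    from meets[OF vimage[OF D(1) sub] this] show ?thesis
      by auto
  qed
  ultimately show ?thesis
    by (simp add: generic_def)
qed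

lemma
  assumes M: "hat_closed M" and P: "P \<in> M" and trees: "\<forall>T\<in>elts P. tree_on omega T"
  shows hat_forcing_in: "hat_forcing P \<in> M"
    and generic_hat: "generic M P G \<Longrightarrow> generic M (hat_forcing P) (hat_tree ` G)"
    and generic_hatE: "generic M (hat_forcing P) H \<Longrightarrow> \<exists>G. generic M P G \<and> H = hat_tree ` G"
proof -
  have image: "hcset (hat_tree ` elts D) \<in> M" if "D \<in> M" "elts D \<subseteq> elts P" for D
  proof -
    have "img2 hat_table ` elts D = hat_tree ` elts D"
      using that trees img2_hat_table by (intro image_cong) auto
    moreover have "img3 hat_table D \<in> M"
      using M that by (auto simp: hat_closed_def)
    ultimately show ?thesis
      by (simp add: img3_def)
  qed
  then show "hat_forcing P \<in> M"
    using P by (auto simp: hat_forcing_def)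
  have bij: "bij_betw hat_tree (elts P) (elts (hat_forcing P))"
    using inj_on_hat_tree[OF trees] by (simp add: bij_betw_def)
  have vimage: "hcset {T \<in> elts P. hat_tree T \<in> elts D} \<in> M"
    if "D \<in> M" "elts D \<subseteq> elts (hat_forcing P)" for D
  proof -
    have "img2 unhat_table ` elts D = {T \<in> elts P. hat_tree T \<in> elts D}"
      using that trees img2_unhat_table by (force simp: image_iff)
    moreover have "img3 unhat_table D \<in> M"
      using M that by (auto simp: hat_closed_def)
    ultimately show ?thesis
      by (simp add: img3_def)
  qed
  show "generic M (hat_forcing P) (hat_tree ` G)" if "generic M P G"
    using trees by (intro generic_image[OF bij _ vimage that] hat_tree_subset_iff) auto
  define k where "k = inv_into (elts P) hat_tree"
  have k: "k (hat_tree T) = T" if "T \<in> elts P" for T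
    unfolding k_def using inj_on_hat_tree[OF trees] that by simp
  show "\<exists>G. generic M P G \<and> H = hat_tree ` G" if H: "generic M (hat_forcing P) H"
  proof (intro exI conjI)
    show "generic M P (k ` H)"
    proof (rule generic_image[OF _ _ _ H])
      show "bij_betw k (elts (hat_forcing P)) (elts P)"
        unfolding k_def by (rule bij_betw_inv_into[OF bij])
      show "elts (k p) \<subseteq> elts (k q) \<longleftrightarrow> elts p \<subseteq> elts q"
        if pq: "p \<in> elts (hat_forcing P)" "q \<in> elts (hat_forcing P)" for p q
      proof -
        obtain S T where "S \<in> elts P" "T \<in> elts P" "p = hat_tree S" "q = hat_tree T"
          using pq unfolding elts_hat_forcing by blast
        then show ?thesis
          using k trees hat_tree_subset_iff by metis
      qed
      show "hcset {q \<in> elts (hat_forcing P). k q \<in> elts D} \<in> M"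
        if D: "D \<in> M" "elts D \<subseteq> elts P" for D
      proof -
        have "{q \<in> elts (hat_forcing P). k q \<in> elts D} = hat_tree ` elts D"
          using D k by auto
        with image[OF D] show ?thesis
          by simp
      qed
    qed
    have "H \<subseteq> hat_tree ` elts P"
      using H by (simp add: generic_def filter_on_def)
    then show "H = hat_tree ` k ` H"
      using k by force
  qed
qed

section \<open>Ranges and models of coded branches\<close>

lemma app_hat: "x \<in> funcs omega omega \<Longrightarrow> i \<in> elts omega \<Longrightarrow> app (hat x) i = block i (app x i)"
  by (auto simp: funcs_def hat_lam)

lemma app_in_omega: "x \<in> funcs omega omega \<Longrightarrow> i \<in> elts omega \<Longrightarrow> app x i \<in> elts omega"
  by (auto simp: funcs_def)

lemma strictly_increasing_hat:
  assumes "x \<in> funcs omega omega"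
  shows "strictly_increasing (hat x)"
  unfolding strictly_increasing_def
proof (intro ballI impI)
  fix i j
  assume i: "i \<in> elts omega" and j: "j \<in> elts omega" and "i \<in> elts j"
  moreover obtain a b a' b' where
    "i = ord_nat a" "app x i = ord_nat a'" "j = ord_nat b" "app x j = ord_nat b'"
    using i j app_in_omega[OF assms i] app_in_omega[OF assms j] unfolding elts_omega by blast
  ultimately show "app (hat x) i \<in> elts (app (hat x) j)"
    using assms by (simp add: app_hat block_less)
qed

lemma ran_of_hat:
  assumes "x \<in> funcs omega omega"
  shows "ran_of (hat x) = (\<lambda>i. block i (app x i)) ` elts omega"
proof -
  from assms obtain h where "x = lam omega h"
    by (auto simp: funcs_def)
  then show ?thesis
    by (auto simp: ran_of_def hat_lam)
qed

text \<open>
  Different blocks are disjoint, so the range of a coded branch remembers at which place each value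
  was taken: every \<open>n\<close> with \<open>x n \<noteq> y n\<close> contributes exactly two ordinals of the \<open>n\<close>-th block to the
  symmetric difference, and no other ordinals occur in it.
\<close>

lemma finite_ran_hat_iff_E0:
  assumes x: "x \<in> funcs omega omega" and y: "y \<in> funcs omega omega"
  shows "finite (sym_diff (ran_of (hat x)) (ran_of (hat y))) \<longleftrightarrow> E0 x y"
proof -
  define D where "D = {n \<in> elts omega. app x n \<noteq> app y n}"
  have sym_diff: "sym_diff (ran_of (hat x)) (ran_of (hat y)) =
      (\<lambda>i. block i (app x i)) ` D \<union> (\<lambda>i. block i (app y i)) ` D"
    unfolding ran_of_hat[OF x] ran_of_hat[OF y] D_def
    using block_inject app_in_omega[OF x] app_in_omega[OF y] by (auto simp: image_iff)
  have "inj_on (\<lambda>i. block i (app x i)) D"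
    using block_inject app_in_omega[OF x] by (auto simp: inj_on_def D_def)
  then show ?thesis
    unfolding sym_diff E0_def D_def[symmetric] by (auto dest: finite_imageD)
qed

text \<open>
  Coding and decoding stay within every model of a large enough fragment, so \<open>x\<close> and its code lie
  in the same models.
\<close>

lemma adjoin_hat:
  assumes "\<And>N. transitive N \<Longrightarrow> models N \<Psi> \<Longrightarrow> hat_closed N" and x: "x \<in> funcs omega omega"
  shows "adjoin \<Psi> M (hat x) = adjoin \<Psi> M x"
proof -
  have part: "omega_partial x"
    using x funcs_omega_partial by blast
  have "hat x \<in> N \<longleftrightarrow> x \<in> N" if "transitive N" "models N \<Psi>" for N
  proof -
    have "hat_closed N"
      using assms(1) that .
    then have "f \<in> N \<Longrightarrow> img hat_table f \<in> N \<and> img unhat_table f \<in> N" for f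
      by (simp add: hat_closed_def)
    then show ?thesis
      using img_hat_table[OF part] img_unhat_table[OF part] by metis
  qed
  then show ?thesis
    unfolding adjoin_def by (metis (no_types, lifting))
qed

section \<open>The coded forcing\<close>

theorem proposition11:
  shows "\<exists>\<Phi>\<^sub>0. finite \<Phi>\<^sub>0 \<and> \<Phi>\<^sub>0 \<subseteq> ZFC \<and>
    (\<forall>\<Phi> \<Psi> M P.
      \<Phi>\<^sub>0 \<subseteq> \<Psi> \<and> \<Psi> \<subseteq> \<Phi> \<and> \<Phi> \<subseteq> ZFC \<and>
      ctm \<Phi> M \<and>
      tree_forcing M omega P \<and>
      generates_extension \<Psi> M omega P \<and>
      (\<forall>x y. generic_branch M omega P x \<and> generic_branch M omega P y \<longrightarrow>
        (adjoin \<Psi> M x = adjoin \<Psi> M y \<longleftrightarrow> E0 x y))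
      \<longrightarrow>
      bij_betw hat_tree (elts P) (elts (hat_forcing P)) \<and>
      (\<forall>S\<in>elts P. \<forall>T\<in>elts P. elts (hat_tree S) \<subseteq> elts (hat_tree T) \<longleftrightarrow> elts S \<subseteq> elts T) \<and>
      tree_forcing M (omult omega omega) (hat_forcing P) \<and>
      (\<forall>G x. generic M P G \<and> branch_of omega G x \<longrightarrow>
        generic M (hat_forcing P) (hat_tree ` G) \<and>
        branch_of (omult omega omega) (hat_tree ` G) (hat x)) \<and>
      Collect (generic_branch M (omult omega omega) (hat_forcing P)) =
        hat ` Collect (generic_branch M omega P) \<and>
      (\<forall>c. generic_branch M (omult omega omega) (hat_forcing P) c \<longrightarrow> strictly_increasing c) \<and>
      (\<forall>c d. generic_branch M (omult omega omega) (hat_forcing P) c \<and>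
             generic_branch M (omult omega omega) (hat_forcing P) d \<longrightarrow>
        (adjoin \<Psi> M c = adjoin \<Psi> M d \<longleftrightarrow> finite (sym_diff (ran_of c) (ran_of d)))))"
proof -
  obtain \<Phi>\<^sub>0 where \<Phi>\<^sub>0: "finite \<Phi>\<^sub>0" "\<Phi>\<^sub>0 \<subseteq> ZFC"
    and closed: "\<And>N. transitive N \<Longrightarrow> models N \<Phi>\<^sub>0 \<Longrightarrow> hat_closed N"
    using ZFC_ensures_hat_closed unfolding ZFC_ensures_def by blast
  show ?thesis
  proof (rule exI[of _ \<Phi>\<^sub>0], intro conjI[OF \<Phi>\<^sub>0(1) conjI[OF \<Phi>\<^sub>0(2)]] allI impI, elim conjE)
    fix \<Phi> \<Psi> M P
    let ?Q = "hat_forcing P" and ?A = "omult omega omega"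
    assume sub: "\<Phi>\<^sub>0 \<subseteq> \<Psi>" "\<Psi> \<subseteq> \<Phi>" and ctm: "ctm \<Phi> M" and forcing: "tree_forcing M omega P"
      and E0: "\<forall>x y. generic_branch M omega P x \<and> generic_branch M omega P y \<longrightarrow>
        (adjoin \<Psi> M x = adjoin \<Psi> M y \<longleftrightarrow> E0 x y)"
    have closed_\<Psi>: "hat_closed N" if "transitive N" "models N \<Psi>" for N
      using closed that models_antimono[OF _ sub(1)] by blast
    then have adjoin: "adjoin \<Psi> M (hat z) = adjoin \<Psi> M z" if "z \<in> funcs omega omega" for z
      using adjoin_hat that by blast
    have M: "hat_closed M"
      using closed_\<Psi> ctm models_antimono[OF _ sub(2)] by (auto simp: ctm_def)
    have P: "P \<in> M" and trees: "\<forall>T\<in>elts P. tree_on omega T"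
      and unique: "\<And>G. generic M P G \<Longrightarrow> \<exists>!x. branch_of omega G x"
      using forcing by (auto simp: tree_forcing_def)
    have branch_iff: "branch_of ?A (hat_tree ` G) c \<longleftrightarrow> (\<exists>x. branch_of omega G x \<and> c = hat x)"
      if "generic M P G" for G c
      using that trees by (intro branch_of_hat_iff) (auto simp: generic_def filter_on_def)
    have branches: "generic_branch M ?A ?Q c \<longleftrightarrow> (\<exists>x. generic_branch M omega P x \<and> c = hat x)" for c
    proof
      assume "generic_branch M ?A ?Q c"
      then obtain G where "generic M P G" "branch_of ?A (hat_tree ` G) c"
        unfolding generic_branch_def using generic_hatE[OF M P trees] by metis
      then show "\<exists>x. generic_branch M omega P x \<and> c = hat x"
        unfolding generic_branch_def using branch_iff by blast
    next
      assume "\<exists>x. generic_branch M omega P x \<and> c = hat x"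
      then obtain G where "generic M P G" "branch_of ?A (hat_tree ` G) c"
        unfolding generic_branch_def using branch_iff by blast
      then show "generic_branch M ?A ?Q c"
        unfolding generic_branch_def using generic_hat[OF M P trees] by blast
    qed
    have funcs: "x \<in> funcs omega omega" if "generic_branch M omega P x" for x
      using that by (auto simp: generic_branch_def branch_of_def)
    have "\<exists>!c. branch_of ?A H c" if H: "generic M ?Q H" for H
    proof -
      obtain G where G: "generic M P G" "H = hat_tree ` G"
        using generic_hatE[OF M P trees H] by blast
      with unique[OF G(1)] branch_iff[OF G(1)] show ?thesis
        by auto
    qed
    then have tree_forcing: "tree_forcing M ?A ?Q"
      using hat_forcing_in[OF M P trees] trees tree_on_hat_tree by (auto simp: tree_forcing_def)
    have branchE: "\<exists>x. generic_branch M omega P x \<and> x \<in> funcs omega omega \<and> c = hat x"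
      if "generic_branch M ?A ?Q c" for c
      using that branches funcs by blast
    show "bij_betw hat_tree (elts P) (elts ?Q) \<and>
      (\<forall>S\<in>elts P. \<forall>T\<in>elts P. elts (hat_tree S) \<subseteq> elts (hat_tree T) \<longleftrightarrow> elts S \<subseteq> elts T) \<and>
      tree_forcing M ?A ?Q \<and>
      (\<forall>G x. generic M P G \<and> branch_of omega G x \<longrightarrow>
        generic M ?Q (hat_tree ` G) \<and> branch_of ?A (hat_tree ` G) (hat x)) \<and>
      Collect (generic_branch M ?A ?Q) = hat ` Collect (generic_branch M omega P) \<and>
      (\<forall>c. generic_branch M ?A ?Q c \<longrightarrow> strictly_increasing c) \<and>
      (\<forall>c d. generic_branch M ?A ?Q c \<and> generic_branch M ?A ?Q d \<longrightarrow>
        (adjoin \<Psi> M c = adjoin \<Psi> M d \<longleftrightarrow> finite (sym_diff (ran_of c) (ran_of d))))"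
    proof (intro conjI ballI allI impI; (elim conjE)?)
      show "bij_betw hat_tree (elts P) (elts ?Q)"
        using inj_on_hat_tree[OF trees] by (simp add: bij_betw_def)
    next
      fix S T
      assume "S \<in> elts P" "T \<in> elts P"
      then show "elts (hat_tree S) \<subseteq> elts (hat_tree T) \<longleftrightarrow> elts S \<subseteq> elts T"
        using trees hat_tree_subset_iff by blast
    next
      show "tree_forcing M ?A ?Q"
        by (rule tree_forcing)
    next
      fix G x
      assume G: "generic M P G" "branch_of omega G x"
      show "generic M ?Q (hat_tree ` G)"
        by (rule generic_hat[OF M P trees G(1)])
      show "branch_of ?A (hat_tree ` G) (hat x)"
        using branch_iff[OF G(1)] G(2) by blast
    next
      show "Collect (generic_branch M ?A ?Q) = hat ` Collect (generic_branch M omega P)"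
        using branches by auto
    next
      fix c
      assume "generic_branch M ?A ?Q c"
      with branchE obtain x where "x \<in> funcs omega omega" "c = hat x"
        by blast
      then show "strictly_increasing c"
        by (simp add: strictly_increasing_hat)
    next
      fix c d
      assume "generic_branch M ?A ?Q c" "generic_branch M ?A ?Q d"
      with branchE obtain x y
        where x: "generic_branch M omega P x" "x \<in> funcs omega omega" "c = hat x"
          and y: "generic_branch M omega P y" "y \<in> funcs omega omega" "d = hat y"
        by metis
      have "adjoin \<Psi> M c = adjoin \<Psi> M d \<longleftrightarrow> adjoin \<Psi> M x = adjoin \<Psi> M y"
        unfolding x(3) y(3) adjoin[OF x(2)] adjoin[OF y(2)] ..
      also have "\<dots> \<longleftrightarrow> E0 x y"
        using E0 x(1) y(1) by blast
      also have "\<dots> \<longleftrightarrow> finite (sym_diff (ran_of c) (ran_of d))"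
        unfolding x(3) y(3) finite_ran_hat_iff_E0[OF x(2) y(2)] ..
      finally show "adjoin \<Psi> M c = adjoin \<Psi> M d \<longleftrightarrow> finite (sym_diff (ran_of c) (ran_of d))" .
    qed
  qed
qed

end
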